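(* Suppose Assumptions A1, A2 and A3 hold, with $p\ge 1$ the constant from A3. Then the limit defining $\mathcal L_\Phi^p$ exists, and the following statements are equivalent: (a) $\mathcal L_\Phi^p<0$. (b) A Markov solution exists in $\mathcal H_p$. (c) A unique Markov solution exists in $\mathcal H_p$. (d) There exists $h\in\mathcal H_p$ such that $T^n h$ converges in $L_p(\pi)$-norm, as $n\to\infty$, to some limit in $\mathcal H_p$. (e) A unique Markov solution $h^*$ exists in $\mathcal H_p$, and $T^n h\to h^*$ in $L_p(\pi)$-norm for every $h\in\mathcal H_p$. Moreover, if (a)–(e) hold, the unique Markov solution satisfies $$h^*(x)=\sum_{n=1}^\infty \mathbb E_x\Big[\Big(\prod_{i=1}^n\Phi_i\Big)G_n\Big]\quad\text{for (}\pi\text{-almost) all } x\in\mathsf X.$$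
   Context: Standing setting: $\mathsf X$ and $\mathsf W$ are separable, completely metrizable topological spaces with their Borel $\sigma$-algebras. On a probability space $(\Omega,\mathscr F,\mathbb P)$, $\{X_t\}_{t\ge0}$ is a stationary Markov process on $\mathsf X$ with transition kernel $\Pi$ and stationary marginal distribution $\pi$; $\Pi^n$ is the $n$-step kernel ($\Pi^1=\Pi$, $\Pi^n(x,B)=\int\Pi^{n-1}(x,dz)\Pi(z,B)$). $\{\eta_t\}_{t\ge1}$ is an iid $\mathsf W$-valued sequence with common law $\nu$, independent of $\{X_t\}$. $\phi,g:\mathsf X\times\mathsf X\times\mathsf W\to[0,\infty)$ are Borel measurable and $\Phi_{t+1}=\phi(X_t,X_{t+1},\eta_{t+1})$, $G_{t+1}=g(X_t,X_{t+1},\eta_{t+1})$ for $t\ge0$. $\mathbb E_x$ denotes expectation conditional on $X_0=x$, $\mathbb E$ the unconditional expectation (so $X_0\sim\pi$), and $\mathbb E_t$ conditional expectation given information at time $t$. For $p\ge1$, $L_p(\pi)$ is the Banach lattice of Borel functions $h:\mathsf X\to\mathbb R$ with $\|h\|_p=(\int|h|^p d\pi)^{1/p}<\infty$ (functions equal $\pi$-a.e. identified, order $\pi$-a.e.), and $\mathcal H_p$ is the set of its nonnegative elements. Valuation operator: $Vh(x)=\int h(y)\big[\int\phi(x,y,\eta)\nu(d\eta)\big]\Pi(x,dy)$. Define $\hat g(x)=\int\int\phi(x,y,\eta)g(x,y,\eta)\nu(d\eta)\Pi(x,dy)$ and the operator $Th=Vh+\hat g$. A Markov solution in $\mathcal H_p$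 is an $h\in\mathcal H_p$ with $h=Th$ ($\pi$-a.e.); equivalently $Y_t=h(X_t)$ satisfies $Y_t=\mathbb E_t[\Phi_{t+1}(Y_{t+1}+G_{t+1})]$ for all $t\ge0$. Assumption A1: $\phi>0$ everywhere (so each $\Phi_t>0$), and $G_t>0$ on a set of positive probability. Assumption A2 (irreducibility): for every Borel $B\subset\mathsf X$ with $\pi(B)>0$ and every $x\in\mathsf X$ there is $n\in\mathbb N$ with $\Pi^n(x,B)>0$. Assumption A3: there is $p\ge1$ such that $\hat g\in\mathcal H_p$ and $V$ is a (bounded) linear map from $L_p(\pi)$ to itself which is eventually compact, i.e. some power $V^i$ is a compact operator on $L_p(\pi)$. $p$-th order stability exponent: $\mathcal L_\Phi^p:=\lim_{n\to\infty}\frac{1}{np}\ln\int\Big(\mathbb E_x\prod_{t=1}^n\Phi_t\Big)^p\pi(dx)$; write $\mathcal L_\Phi:=\mathcal L_\Phi^1=\lim_{n}\frac1n\ln\mathbb E\prod_{t=1}^n\Phi_t$. *)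

theory Defs
  imports "HOL-Probability.Probability"
begin

text \<open>
  pathE K N n x F is the expectation E_x F(X_0..X_n, eta_1..eta_n) for a Markov
  chain X with transition kernel K started at X_0 = x and an iid noise sequence
  eta with law N independent of X, written as the iterated integral
  int K(x,dy_1) int N(de_1) int K(y_1,dy_2) int N(de_2) ... F.
  In F, the first argument is the path t |-> X_t (X_0 = x), the second the
  noise t |-> eta_t (only indices 1..n are meaningful).
\<close>
fun pathE :: "('x \<Rightarrow> 'x measure) \<Rightarrow> 'w measure \<Rightarrow> nat \<Rightarrow> 'x
              \<Rightarrow> ((nat \<Rightarrow> 'x) \<Rightarrow> (nat \<Rightarrow> 'w) \<Rightarrow> ennreal) \<Rightarrow> ennreal" where
  "pathE K N 0 x F = F (\<lambda>_. x) (\<lambda>_. undefined)"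
| "pathE K N (Suc n) x F =
     (\<integral>\<^sup>+ y. \<integral>\<^sup>+ e. pathE K N n y
          (\<lambda>xs es. F (case_nat x xs) (\<lambda>t. if t = 1 then e else es (t - 1))) \<partial>N \<partial>K x)"

definition Eprod :: "('x \<Rightarrow> 'x measure) \<Rightarrow> 'w measure \<Rightarrow> ('x \<Rightarrow> 'x \<Rightarrow> 'w \<Rightarrow> real)
                      \<Rightarrow> nat \<Rightarrow> 'x \<Rightarrow> ennreal" where
  "Eprod K N \<phi> n x =
     pathE K N n x (\<lambda>X E. \<Prod>t\<in>{1..n}. ennreal (\<phi> (X (t - 1)) (X t) (E t)))"

definition EprodG :: "('x \<Rightarrow> 'x measure) \<Rightarrow> 'w measure \<Rightarrow> ('x \<Rightarrow> 'x \<Rightarrow> 'w \<Rightarrow> real)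
                      \<Rightarrow> ('x \<Rightarrow> 'x \<Rightarrow> 'w \<Rightarrow> real) \<Rightarrow> nat \<Rightarrow> 'x \<Rightarrow> ennreal" where
  "EprodG K N \<phi> g n x =
     pathE K N n x (\<lambda>X E. (\<Prod>t\<in>{1..n}. ennreal (\<phi> (X (t - 1)) (X t) (E t)))
                          * ennreal (g (X (n - 1)) (X n) (E n)))"

fun kpow :: "('x::topological_space \<Rightarrow> 'x measure) \<Rightarrow> nat \<Rightarrow> 'x \<Rightarrow> 'x measure" where
  "kpow K 0 x = return borel x"
| "kpow K (Suc n) x = kpow K n x \<bind> K"

definition Lp :: "real \<Rightarrow> 'x::topological_space measure \<Rightarrow> ('x \<Rightarrow> real) \<Rightarrow> bool" where
  "Lp p \<pi> h \<longleftrightarrow> h \<in> borel_measurable borel \<and> integrable \<pi> (\<lambda>x. \<bar>h x\<bar> powr p)"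

definition Hp :: "real \<Rightarrow> 'x::topological_space measure \<Rightarrow> ('x \<Rightarrow> real) \<Rightarrow> bool" where
  "Hp p \<pi> h \<longleftrightarrow> Lp p \<pi> h \<and> (AE x in \<pi>. 0 \<le> h x)"

definition lpnorm :: "real \<Rightarrow> 'x measure \<Rightarrow> ('x \<Rightarrow> real) \<Rightarrow> real" where
  "lpnorm p \<pi> h = (\<integral>x. \<bar>h x\<bar> powr p \<partial>\<pi>) powr (1 / p)"

definition phibar :: "'w measure \<Rightarrow> ('x \<Rightarrow> 'x \<Rightarrow> 'w \<Rightarrow> real) \<Rightarrow> 'x \<Rightarrow> 'x \<Rightarrow> real" where
  "phibar N \<phi> x y = enn2real (\<integral>\<^sup>+ e. ennreal (\<phi> x y e) \<partial>N)"

definition Vop :: "('x \<Rightarrow> 'x measure) \<Rightarrow> 'w measure \<Rightarrow> ('x \<Rightarrow> 'x \<Rightarrow> 'w \<Rightarrow> real)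
                    \<Rightarrow> ('x \<Rightarrow> real) \<Rightarrow> 'x \<Rightarrow> real" where
  "Vop K N \<phi> h x = (\<integral>y. h y * phibar N \<phi> x y \<partial>K x)"

definition ghat :: "('x \<Rightarrow> 'x measure) \<Rightarrow> 'w measure \<Rightarrow> ('x \<Rightarrow> 'x \<Rightarrow> 'w \<Rightarrow> real)
                    \<Rightarrow> ('x \<Rightarrow> 'x \<Rightarrow> 'w \<Rightarrow> real) \<Rightarrow> 'x \<Rightarrow> real" where
  "ghat K N \<phi> g x = enn2real (\<integral>\<^sup>+ y. \<integral>\<^sup>+ e. ennreal (\<phi> x y e * g x y e) \<partial>N \<partial>K x)"

definition Top :: "('x \<Rightarrow> 'x measure) \<Rightarrow> 'w measure \<Rightarrow> ('x \<Rightarrow> 'x \<Rightarrow> 'w \<Rightarrow> real)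
                    \<Rightarrow> ('x \<Rightarrow> 'x \<Rightarrow> 'w \<Rightarrow> real) \<Rightarrow> ('x \<Rightarrow> real) \<Rightarrow> 'x \<Rightarrow> real" where
  "Top K N \<phi> g h x = Vop K N \<phi> h x + ghat K N \<phi> g x"

definition V_well_defined :: "real \<Rightarrow> 'x::topological_space measure \<Rightarrow> ('x \<Rightarrow> 'x measure)
    \<Rightarrow> 'w measure \<Rightarrow> ('x \<Rightarrow> 'x \<Rightarrow> 'w \<Rightarrow> real) \<Rightarrow> bool" where
  "V_well_defined p \<pi> K N \<phi> \<longleftrightarrow>
     (\<forall>h. Lp p \<pi> h \<longrightarrow>
        (AE x in \<pi>. (\<integral>\<^sup>+ y. ennreal \<bar>h y\<bar> * (\<integral>\<^sup>+ e. ennreal (\<phi> x y e) \<partial>N) \<partial>K x) < \<infinity>))"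

definition bounded_on_Lp :: "real \<Rightarrow> 'x::topological_space measure
    \<Rightarrow> (('x \<Rightarrow> real) \<Rightarrow> 'x \<Rightarrow> real) \<Rightarrow> bool" where
  "bounded_on_Lp p \<pi> A \<longleftrightarrow>
     (\<forall>h. Lp p \<pi> h \<longrightarrow> Lp p \<pi> (A h)) \<and>
     (\<exists>C. \<forall>h. Lp p \<pi> h \<longrightarrow> lpnorm p \<pi> (A h) \<le> C * lpnorm p \<pi> h)"

definition compact_on_Lp :: "real \<Rightarrow> 'x::topological_space measure
    \<Rightarrow> (('x \<Rightarrow> real) \<Rightarrow> 'x \<Rightarrow> real) \<Rightarrow> bool" where
  "compact_on_Lp p \<pi> A \<longleftrightarrow>
     (\<forall>hs :: nat \<Rightarrow> 'x \<Rightarrow> real. (\<forall>k. Lp p \<pi> (hs k) \<and> lpnorm p \<pi> (hs k) \<le> 1) \<longrightarrow>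
        (\<exists>r f. strict_mono r \<and> Lp p \<pi> f \<and>
               (\<lambda>k. lpnorm p \<pi> (\<lambda>x. A (hs (r k)) x - f x)) \<longlonglongrightarrow> 0))"

definition markov_solution :: "real \<Rightarrow> 'x::topological_space measure \<Rightarrow> ('x \<Rightarrow> 'x measure)
    \<Rightarrow> 'w measure \<Rightarrow> ('x \<Rightarrow> 'x \<Rightarrow> 'w \<Rightarrow> real) \<Rightarrow> ('x \<Rightarrow> 'x \<Rightarrow> 'w \<Rightarrow> real)
    \<Rightarrow> ('x \<Rightarrow> real) \<Rightarrow> bool" where
  "markov_solution p \<pi> K N \<phi> g h \<longleftrightarrow>
     Hp p \<pi> h \<and> (AE x in \<pi>. h x = Top K N \<phi> g h x)"

definition stab_seq :: "real \<Rightarrow> 'x measure \<Rightarrow> ('x \<Rightarrow> 'x measure) \<Rightarrow> 'w measure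
    \<Rightarrow> ('x \<Rightarrow> 'x \<Rightarrow> 'w \<Rightarrow> real) \<Rightarrow> nat \<Rightarrow> real" where
  "stab_seq p \<pi> K N \<phi> n =
     ln (enn2real (\<integral>\<^sup>+ x. ennreal (enn2real (Eprod K N \<phi> n x) powr p) \<partial>\<pi>)) / (real n * p)"

end

theory Submission
  imports Defs
begin

text \<open>
  \<open>V\<close> is a positive operator on \<open>L\<^sub>p\<close>, and A2 together with \<open>\<phi> > 0\<close> makes it irreducible in the
  strong sense that \<open>f \<ge> 0\<close>, \<open>f \<noteq> 0\<close> implies that a.e. some \<open>V\<^sup>n f\<close> is positive. Write \<open>b n\<close> for
  the operator norm of \<open>V\<^sup>n\<close>, and let \<open>K = V\<^sup>i\<close> be compact. No spectral theory is needed.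

  Since \<open>K\<close> maps the unit ball into a relatively compact set, for every a.e. positive \<open>q\<close> and
  \<open>\<epsilon> > 0\<close> there is an \<open>m\<close> with \<open>b (n + i) \<le> m \<parallel>V\<^sup>n q\<parallel> + \<epsilon> b n\<close> for all \<open>n\<close>. With \<open>q = 1\<close> this
  forces the stability exponent to exist and to be the logarithm of the spectral radius; with
  \<open>q\<close> the minimal solution, for which \<open>\<parallel>V\<^sup>n q\<parallel> \<rightarrow> 0\<close>, it shows that existence of a solution makes
  the exponent negative. The converse is the Neumann series. That the spectral radius is positive,
  so that the exponent is a real number, is shown by iterating \<open>f \<mapsto> min 1 (c (V\<^sup>0 + \<dots> + V\<^sup>l) K f)\<close>
  on a small ball around \<open>1\<close>.
\<close>

subsection \<open>The seminormed space of \<open>p\<close>-integrable functions\<close>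

text \<open>Two obstacles shape the proof. In general 1 is not an interior point of the positive
  cone of L_p, so a priori its orbit may grow more slowly than the norms \<open>b n\<close>. After
  rescaling by e^{-growth n} these norms stay above 1 but may be unbounded, with subexponential
  growth only; the comparison with an orbit can therefore lose a fixed power of the rescaled norm, a
  loss that disappears in (1/n) ln. Likewise an arbitrary solution h need not a priori satisfy V^n h
  \<longlonglongrightarrow> 0. The minimal one does, because V^n q is the tail of its own series,
  and it is a.e. positive because irreducibility spreads the nonzero function \<open>ghat\<close>.

  The second obstacle is the passage between pointwise and a.e. statements. A2 speaks of every point
  and path expectations are extended reals, whereas V is a Bochner integral acting on
  representatives and is known to be additive only a.e. The \<open>ennreal\<close>-valued operator
  \<open>U\<close>, defined everywhere, carries A2 and the path expectations over to V.\<close>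

lemma powr_convex_combination:
  fixes a b \<theta> p :: real
  assumes "1 \<le> p" "0 \<le> a" "0 \<le> b" "0 \<le> \<theta>" "\<theta> \<le> 1"
  shows "(\<theta> * a + (1 - \<theta>) * b) powr p \<le> \<theta> * a powr p + (1 - \<theta>) * b powr p"
proof -
  \<comment> \<open>If \<open>a\<close> or \<open>b\<close> is 0, convexity degenerates to this
    scaling bound, which rests on t^p \<le> t for t in [0, 1].\<close>
  have *: "(t * c) powr p \<le> t * c powr p" if "0 \<le> t" "t \<le> 1" "0 \<le> c" for t c :: real
  proof -
    have "t powr p \<le> t"
      using that \<open>1 \<le> p\<close> powr_mono'[of 1 p t] by (cases "t = 0") auto
    then have "t powr p * c powr p \<le> t * c powr p"
      by (intro mult_right_mono) auto
    then show ?thesis using that by (simp add: powr_mult)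
  qed
  show ?thesis
  proof (cases "a = 0 \<or> b = 0")
    case True
    then show ?thesis
    proof
      assume "a = 0" then show ?thesis using *[of "1 - \<theta>" b] assms by simp
    next
      assume "b = 0" then show ?thesis using *[of \<theta> a] assms by simp
    qed
  next
    case False
    then have "a > 0" "b > 0" using assms by auto
    then show ?thesis
      using convex_onD[OF powr_convex[OF \<open>1 \<le> p\<close>], of "1 - \<theta>" a b] assms by (simp add: algebra_simps)
  qed
qed

text \<open>No quotient is formed: \<open>N\<close> is only a seminorm on functions, and a.e.
  statements take the place of equality. On a probability measure every constant is p-integrable, so
  the orbit of 1 makes sense.\<close>

locale Lp_space = prob_space M for M :: "'a::topological_space measure" +
  fixes p :: real
  assumes p1: "1 \<le> p" and sets_M: "sets M = sets borel"
begin

abbreviation E :: "('a \<Rightarrow> real) \<Rightarrow> bool" where "E \<equiv> Lp p M"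
abbreviation N :: "('a \<Rightarrow> real) \<Rightarrow> real" where "N \<equiv> lpnorm p M"

lemma meas_M: "f \<in> borel_measurable M \<longleftrightarrow> f \<in> borel_measurable borel"
  using sets_M measurable_cong_sets[OF sets_M refl] by blast

lemma E_measurable: "E f \<Longrightarrow> f \<in> borel_measurable borel"
  by (simp add: Lp_def)

lemma E_integrable: "E f \<Longrightarrow> integrable M (\<lambda>x. \<bar>f x\<bar> powr p)"
  by (simp add: Lp_def)

lemma E_mono:
  assumes "E g" "f \<in> borel_measurable borel" "AE x in M. \<bar>f x\<bar> \<le> \<bar>g x\<bar>"
  shows "E f"
proof -
  have "integrable M (\<lambda>x. \<bar>f x\<bar> powr p)"
  proof (rule Bochner_Integration.integrable_bound[OF E_integrable[OF assms(1)]])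
    show "(\<lambda>x. \<bar>f x\<bar> powr p) \<in> borel_measurable M"
      using assms(2) by (simp add: meas_M)
    show "AE x in M. norm (\<bar>f x\<bar> powr p) \<le> norm (\<bar>g x\<bar> powr p)"
      using assms(3) by eventually_elim (use p1 in \<open>auto intro!: powr_mono2\<close>)
  qed
  with assms(2) show ?thesis by (simp add: Lp_def)
qed

lemma E_cmult: "E f \<Longrightarrow> E (\<lambda>x. c * f x)"
  by (auto simp: Lp_def abs_mult powr_mult)

lemma E_abs: "E f \<Longrightarrow> E (\<lambda>x. \<bar>f x\<bar>)"
  by (auto simp: Lp_def)

lemma E_const: "E (\<lambda>x. c)"
  by (simp add: Lp_def)

lemma E_add:
  assumes "E f" "E g" shows "E (\<lambda>x. f x + g x)"
proof -
  have m: "(\<lambda>x. f x + g x) \<in> borel_measurable borel"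
    using assms by (auto dest!: E_measurable)
  have "integrable M (\<lambda>x. \<bar>f x + g x\<bar> powr p)"
  proof (rule Bochner_Integration.integrable_bound)
    show "integrable M (\<lambda>x. 2 powr p * (\<bar>f x\<bar> powr p + \<bar>g x\<bar> powr p))"
      using assms by (auto dest!: E_integrable)
    show "(\<lambda>x. \<bar>f x + g x\<bar> powr p) \<in> borel_measurable M"
      using m by (simp add: meas_M)
    show "AE x in M. norm (\<bar>f x + g x\<bar> powr p) \<le> norm (2 powr p * (\<bar>f x\<bar> powr p + \<bar>g x\<bar> powr p))"
    proof (rule AE_I2)
      fix x
      have "\<bar>f x + g x\<bar> powr p \<le> (2 * max \<bar>f x\<bar> \<bar>g x\<bar>) powr p"
        using p1 by (intro powr_mono2) auto
      also have "\<dots> = 2 powr p * max \<bar>f x\<bar> \<bar>g x\<bar> powr p"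
        by (simp add: powr_mult)
      also have "\<dots> \<le> 2 powr p * (\<bar>f x\<bar> powr p + \<bar>g x\<bar> powr p)"
        by (intro mult_left_mono) (auto simp: max_def)
      finally show "norm (\<bar>f x + g x\<bar> powr p) \<le> norm (2 powr p * (\<bar>f x\<bar> powr p + \<bar>g x\<bar> powr p))"
        by simp
    qed
  qed
  with m show ?thesis by (simp add: Lp_def)
qed

lemma E_diff: assumes "E f" "E g" shows "E (\<lambda>x. f x - g x)"
  using E_add[OF assms(1) E_cmult[OF assms(2), of "-1"]] by simp

lemma E_sum: assumes "\<And>i. i \<in> I \<Longrightarrow> E (f i)" shows "E (\<lambda>x. \<Sum>i\<in>I. f i x)"
  using assms by (induction I rule: infinite_finite_induct) (auto simp: E_const intro: E_add)

lemma E_min: assumes "E f" "E g" shows "E (\<lambda>x. min (f x) (g x))"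
proof -
  have "E (\<lambda>x. \<bar>f x\<bar> + \<bar>g x\<bar>)" using assms by (intro E_add E_abs)
  moreover have "(\<lambda>x. min (f x) (g x)) \<in> borel_measurable borel"
    using assms by (auto dest!: E_measurable)
  ultimately show ?thesis by (rule E_mono) auto
qed

lemma E_max: assumes "E f" "E g" shows "E (\<lambda>x. max (f x) (g x))"
proof -
  have "E (\<lambda>x. \<bar>f x\<bar> + \<bar>g x\<bar>)" using assms by (intro E_add E_abs)
  moreover have "(\<lambda>x. max (f x) (g x)) \<in> borel_measurable borel"
    using assms by (auto dest!: E_measurable)
  ultimately show ?thesis by (rule E_mono) auto
qed

lemma N_nonneg: "0 \<le> N f"
  by (simp add: lpnorm_def)

lemma N_powr: "N f powr p = (\<integral>x. \<bar>f x\<bar> powr p \<partial>M)"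
  using p1 by (simp add: lpnorm_def powr_powr powr_one_gt_zero_iff)

lemma N_mono:
  assumes "E f" "E g" "AE x in M. \<bar>f x\<bar> \<le> \<bar>g x\<bar>"
  shows "N f \<le> N g"
proof -
  have "(\<integral>x. \<bar>f x\<bar> powr p \<partial>M) \<le> (\<integral>x. \<bar>g x\<bar> powr p \<partial>M)"
    using assms p1 by (intro integral_mono_AE E_integrable) (auto elim!: eventually_mono intro!: powr_mono2)
  then show ?thesis unfolding lpnorm_def using p1 by (intro powr_mono2) auto
qed

lemma N_cong: assumes "E f" "E g" "AE x in M. f x = g x" shows "N f = N g"
  by (intro antisym N_mono assms) (use assms(3) in \<open>auto elim: eventually_mono\<close>)

lemma N_cmult: "N (\<lambda>x. c * f x) = \<bar>c\<bar> * N f"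
  using p1 by (simp add: lpnorm_def abs_mult powr_mult powr_powr)

lemma N_abs: "N (\<lambda>x. \<bar>f x\<bar>) = N f"
  by (simp add: lpnorm_def)

lemma N_minus: "N (\<lambda>x. f x - g x) = N (\<lambda>x. g x - f x)"
  by (simp add: lpnorm_def abs_minus_commute)

lemma N_const: "N (\<lambda>x. c) = \<bar>c\<bar>"
  using p1 by (simp add: lpnorm_def powr_powr prob_space)

lemma N_eq_0_iff: assumes "E f" shows "N f = 0 \<longleftrightarrow> (AE x in M. f x = 0)"
proof -
  have "N f = 0 \<longleftrightarrow> (\<integral>x. \<bar>f x\<bar> powr p \<partial>M) = 0"
    by (simp add: lpnorm_def)
  also have "\<dots> \<longleftrightarrow> (AE x in M. \<bar>f x\<bar> powr p = 0)"
    by (intro integral_nonneg_eq_0_iff_AE E_integrable assms) auto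
  finally show ?thesis by simp
qed

text \<open>Minkowski's inequality by convexity: (|f| + |g|)/s is the combination of |f|/N f and
  |g|/N g with weights N f/s and N g/s. Taking p-th powers and integrating bounds the left side by
  1. Null functions are treated apart because of the divisions.\<close>

lemma N_add: assumes f: "E f" and g: "E g" shows "N (\<lambda>x. f x + g x) \<le> N f + N g"
proof -
  consider "N f = 0" | "N g = 0" | "N f > 0" "N g > 0"
    using N_nonneg[of f] N_nonneg[of g] by linarith
  then show ?thesis
  proof cases
    case 1
    then have "AE x in M. f x + g x = g x" using N_eq_0_iff[OF f] by (auto elim: eventually_mono)
    then have "N (\<lambda>x. f x + g x) = N g" using f g by (intro N_cong E_add)
    then show ?thesis using 1 by simp
  next
    case 2
    then have "AE x in M. f x + g x = f x" using N_eq_0_iff[OF g] by (auto elim: eventually_mono)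
    then have "N (\<lambda>x. f x + g x) = N f" using f g by (intro N_cong E_add)
    then show ?thesis using 2 by simp
  next
    case 3
    define s where "s = N f + N g"
    define \<theta> where "\<theta> = N f / s"
    have s: "s > 0" "0 \<le> \<theta>" "\<theta> \<le> 1" "1 - \<theta> = N g / s" using 3 by (auto simp: s_def \<theta>_def field_simps)
    have pt: "\<bar>f x + g x\<bar> powr p \<le> s powr p *
          (\<theta> * (\<bar>f x\<bar> powr p / N f powr p) + (1 - \<theta>) * (\<bar>g x\<bar> powr p / N g powr p))" for x
    proof -
      have "\<bar>f x + g x\<bar> \<le> s * (\<theta> * (\<bar>f x\<bar> / N f) + (1 - \<theta>) * (\<bar>g x\<bar> / N g))"
        using 3 s(1) unfolding s(4) by (simp add: \<theta>_def distrib_left)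
      then have "\<bar>f x + g x\<bar> powr p \<le> (s * (\<theta> * (\<bar>f x\<bar> / N f) + (1 - \<theta>) * (\<bar>g x\<bar> / N g))) powr p"
        using p1 by (intro powr_mono2) auto
      also have "\<dots> = s powr p * (\<theta> * (\<bar>f x\<bar> / N f) + (1 - \<theta>) * (\<bar>g x\<bar> / N g)) powr p"
        by (rule powr_mult)
      also have "\<dots> \<le> s powr p * (\<theta> * (\<bar>f x\<bar> / N f) powr p + (1 - \<theta>) * (\<bar>g x\<bar> / N g) powr p)"
        using p1 s 3 by (intro mult_left_mono powr_convex_combination) auto
      finally show ?thesis using 3 by (simp add: powr_divide)
    qed
    have "N (\<lambda>x. f x + g x) powr p = (\<integral>x. \<bar>f x + g x\<bar> powr p \<partial>M)" by (rule N_powr)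
    also have "\<dots> \<le> (\<integral>x. s powr p *
          (\<theta> * (\<bar>f x\<bar> powr p / N f powr p) + (1 - \<theta>) * (\<bar>g x\<bar> powr p / N g powr p)) \<partial>M)"
      using E_integrable[OF f] E_integrable[OF g] E_integrable[OF E_add[OF f g]] pt
      by (intro integral_mono) auto
    also have "\<dots> = s powr p * (\<theta> * ((\<integral>x. \<bar>f x\<bar> powr p \<partial>M) / N f powr p) + (1 - \<theta>) * ((\<integral>x. \<bar>g x\<bar> powr p \<partial>M) / N g powr p))"
      using E_integrable[OF f] E_integrable[OF g] by simp
    also have "\<dots> = s powr p"
      unfolding N_powr[symmetric] using 3 by simp
    finally have "N (\<lambda>x. f x + g x) powr p \<le> s powr p" .
    then have "(N (\<lambda>x. f x + g x) powr p) powr (1/p) \<le> (s powr p) powr (1/p)"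
      by (rule powr_mono2[rotated 2]) (use p1 in auto)
    moreover have inv: "(y powr p) powr (1/p) = y" if "0 \<le> y" for y :: real
      using that p1 by (simp add: powr_powr)
    ultimately have "N (\<lambda>x. f x + g x) \<le> s"
      using inv[OF N_nonneg] inv[OF less_imp_le[OF s(1)]] by metis
    then show ?thesis by (simp add: s_def)
  qed
qed

lemma N_triangle: assumes "E f" "E g" "E h" shows "N (\<lambda>x. f x - h x) \<le> N (\<lambda>x. f x - g x) + N (\<lambda>x. g x - h x)"
  using N_add[OF E_diff[OF assms(1,2)] E_diff[OF assms(2,3)]] by simp

lemma N_reverse: assumes "E f" "E g" shows "N f \<le> N g + N (\<lambda>x. f x - g x)"
  using N_add[OF assms(2) E_diff[OF assms]] by simp

lemma N_sum: assumes "\<And>i. i \<in> I \<Longrightarrow> E (f i)" shows "N (\<lambda>x. \<Sum>i\<in>I. f i x) \<le> (\<Sum>i\<in>I. N (f i))"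
  using assms
proof (induction I rule: infinite_finite_induct)
  case (insert i I)
  have "N (\<lambda>x. f i x + (\<Sum>i\<in>I. f i x)) \<le> N (f i) + N (\<lambda>x. \<Sum>i\<in>I. f i x)"
    using insert by (intro N_add E_sum) auto
  also have "\<dots> \<le> N (f i) + (\<Sum>i\<in>I. N (f i))" using insert by auto
  finally show ?case using insert by simp
qed (simp_all add: N_const)

text \<open>Order continuity of the norm; it turns the a.e. convergences met below into norm
  convergence.\<close>

lemma N_dominated_tendsto_0:
  assumes E: "\<And>n. E (f n)" and g: "E g" and dom: "\<And>n. AE x in M. \<bar>f n x\<bar> \<le> \<bar>g x\<bar>"
    and lim: "AE x in M. (\<lambda>n. f n x) \<longlonglongrightarrow> 0"
  shows "(\<lambda>n. N (f n)) \<longlonglongrightarrow> 0"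
proof -
  have "(\<lambda>n. \<integral>x. \<bar>f n x\<bar> powr p \<partial>M) \<longlonglongrightarrow> (\<integral>x. 0 \<partial>M)"
  proof (rule integral_dominated_convergence)
    show "integrable M (\<lambda>x. \<bar>g x\<bar> powr p)" by (rule E_integrable[OF g])
    show "(\<lambda>x. \<bar>f n x\<bar> powr p) \<in> borel_measurable M" for n
      using E_integrable[OF E] by blast
    show "AE x in M. norm (\<bar>f n x\<bar> powr p) \<le> \<bar>g x\<bar> powr p" for n
      using dom[of n] by eventually_elim (use p1 in \<open>auto intro!: powr_mono2\<close>)
    show "AE x in M. (\<lambda>n. \<bar>f n x\<bar> powr p) \<longlonglongrightarrow> 0"
      using lim
    proof eventually_elim
      case (elim x)
      have "(\<lambda>n. \<bar>f n x\<bar> powr p) \<longlonglongrightarrow> \<bar>0\<bar> powr p"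
        using p1 elim by (intro tendsto_powr' tendsto_rabs tendsto_const) auto
      then show ?case by simp
    qed
  qed simp
  then have "(\<lambda>n. (\<integral>x. \<bar>f n x\<bar> powr p \<partial>M) powr (1/p)) \<longlonglongrightarrow> (\<integral>x. 0 \<partial>M) powr (1/p)"
    using p1 by (intro tendsto_powr' tendsto_const) (auto simp: eventually_sequentially)
  then show ?thesis by (simp add: lpnorm_def)
qed

text \<open>Monotone convergence bounds the integral of the supremum \<open>G\<close> of the p-th
  powers by C^p. So \<open>G\<close> is a.e. finite, the pointwise limit exists a.e., and its p-th
  power is dominated by \<open>G\<close>.\<close>

lemma N_monotone_limit:
  assumes E: "\<And>n. E (s n)" and nn: "\<And>n. AE x in M. 0 \<le> s n x"
    and inc: "\<And>n. AE x in M. s n x \<le> s (Suc n) x" and bd: "\<And>n. N (s n) \<le> C"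
  obtains q where "E q" "AE x in M. (\<lambda>n. s n x) \<longlonglongrightarrow> q x" "\<And>n. AE x in M. s n x \<le> q x"
    "(\<lambda>n. N (\<lambda>x. q x - s n x)) \<longlonglongrightarrow> 0"
proof -
  define q where "q x = lim (\<lambda>n. s n x)" for x
  have sm[measurable]: "s n \<in> borel_measurable borel" for n using E by (rule E_measurable)
  have qm[measurable]: "q \<in> borel_measurable borel" unfolding q_def by measurable
  have good: "AE x in M. (\<forall>n. 0 \<le> s n x) \<and> incseq (\<lambda>n. s n x)"
    using nn inc by (simp add: AE_all_countable incseq_Suc_iff)
  define G where "G x = (SUP n. ennreal (\<bar>s n x\<bar> powr p))" for x
  have Gm: "G \<in> borel_measurable M"
    using sm unfolding G_def meas_M[symmetric] by measurable
  have "(\<integral>\<^sup>+x. G x \<partial>M) = (SUP n. \<integral>\<^sup>+x. ennreal (\<bar>s n x\<bar> powr p) \<partial>M)"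
    unfolding G_def
  proof (rule nn_integral_monotone_convergence_SUP_AE)
    show "AE x in M. ennreal (\<bar>s i x\<bar> powr p) \<le> ennreal (\<bar>s (Suc i) x\<bar> powr p)" for i
      using good by eventually_elim (use p1 in \<open>auto intro!: ennreal_leI powr_mono2 dest: incseq_SucD\<close>)
    show "(\<lambda>x. ennreal (\<bar>s i x\<bar> powr p)) \<in> borel_measurable M" for i
      using E_integrable[OF E] by measurable
  qed
  also have "\<dots> \<le> ennreal (C powr p)"
  proof (rule SUP_least)
    fix n
    have "(\<integral>\<^sup>+x. ennreal (\<bar>s n x\<bar> powr p) \<partial>M) = ennreal (\<integral>x. \<bar>s n x\<bar> powr p \<partial>M)"
      using E_integrable[OF E] by (intro nn_integral_eq_integral) auto
    also have "\<dots> \<le> ennreal (C powr p)"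
      unfolding N_powr[symmetric] using bd[of n] N_nonneg p1 by (intro ennreal_leI powr_mono2) auto
    finally show "(\<integral>\<^sup>+x. ennreal (\<bar>s n x\<bar> powr p) \<partial>M) \<le> ennreal (C powr p)" .
  qed
  finally have Gint: "(\<integral>\<^sup>+x. G x \<partial>M) < \<infinity>" by (simp add: le_less_trans)
  have Gfin: "AE x in M. G x \<noteq> \<infinity>"
    using Gint Gm by (intro nn_integral_PInf_AE) auto
  have bdd: "AE x in M. \<forall>n. s n x powr p \<le> enn2real (G x)"
    using Gfin good
  proof eventually_elim
    case (elim x)
    show ?case
    proof
      fix n
      have "ennreal (\<bar>s n x\<bar> powr p) \<le> G x" unfolding G_def by (rule SUP_upper) simp
      then show "s n x powr p \<le> enn2real (G x)"
        using elim enn2real_mono[of "ennreal (\<bar>s n x\<bar> powr p)" "G x"] by (auto simp: top.not_eq_extremum)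
    qed
  qed
  have conv: "AE x in M. (\<lambda>n. s n x) \<longlonglongrightarrow> q x"
    using bdd good
  proof eventually_elim
    case (elim x)
    have "s n x \<le> enn2real (G x) powr (1/p)" for n
    proof -
      have "s n x = (s n x powr p) powr (1/p)" using p1 elim by (simp add: powr_powr)
      also have "\<dots> \<le> enn2real (G x) powr (1/p)" using elim p1 by (intro powr_mono2) auto
      finally show ?thesis .
    qed
    then obtain L where "(\<lambda>n. s n x) \<longlonglongrightarrow> L"
      using elim incseq_convergent[of "\<lambda>n. s n x"] by blast
    then have "convergent (\<lambda>n. s n x)" by (rule convergentI)
    then show ?case by (simp add: q_def convergent_LIMSEQ_iff)
  qed
  have le: "AE x in M. s n x \<le> q x" for n
    using conv good by eventually_elim (auto intro: incseq_le)
  have q_nn: "AE x in M. 0 \<le> q x" using le[of 0] nn[of 0] by eventually_elim auto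
  have Eq: "E q"
  proof -
    have "integrable M (\<lambda>x. \<bar>q x\<bar> powr p)"
    proof (rule integrableI_bounded)
      show "(\<lambda>x. \<bar>q x\<bar> powr p) \<in> borel_measurable M" using qm by (simp add: meas_M)
      have "(\<integral>\<^sup>+x. ennreal (norm (\<bar>q x\<bar> powr p)) \<partial>M) \<le> (\<integral>\<^sup>+x. G x \<partial>M)"
      proof (rule nn_integral_mono_AE)
        show "AE x in M. ennreal (norm (\<bar>q x\<bar> powr p)) \<le> G x"
          using bdd conv Gfin q_nn good
        proof eventually_elim
          case (elim x)
          have "(\<lambda>n. s n x powr p) \<longlonglongrightarrow> q x powr p"
            using elim p1 by (intro tendsto_powr2 tendsto_const) (auto simp: eventually_sequentially)
          then have "q x powr p \<le> enn2real (G x)" using elim by (intro LIMSEQ_le_const2) auto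
          then have "ennreal (q x powr p) \<le> ennreal (enn2real (G x))" by (rule ennreal_leI)
          moreover have "ennreal (enn2real (G x)) = G x" using elim by (simp add: top.not_eq_extremum)
          ultimately show ?case using elim by simp
        qed
      qed
      then show "(\<integral>\<^sup>+x. ennreal (norm (\<bar>q x\<bar> powr p)) \<partial>M) < \<infinity>" using Gint by (rule le_less_trans)
    qed
    then show ?thesis by (simp add: Lp_def)
  qed
  have "(\<lambda>n. N (\<lambda>x. q x - s n x)) \<longlonglongrightarrow> 0"
  proof (rule N_dominated_tendsto_0[OF _ Eq])
    show "E (\<lambda>x. q x - s n x)" for n by (intro E_diff Eq E)
    show "AE x in M. \<bar>q x - s n x\<bar> \<le> \<bar>q x\<bar>" for n
      using le[of n] nn[of n] by eventually_elim auto
    show "AE x in M. (\<lambda>n. q x - s n x) \<longlonglongrightarrow> 0"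
      using conv
    proof eventually_elim
      case (elim x)
      then show ?case using tendsto_diff[OF tendsto_const[of "q x"] elim] by simp
    qed
  qed
  with Eq conv le show ?thesis by (rule that)
qed

end

subsection \<open>Positive operators modulo null sets\<close>

context Lp_space
begin

text \<open>The operator acts on representatives, so its algebraic laws are demanded only a.e. That
  it respects a.e. equality is not part of the definition: it follows by using positivity in both
  directions, see \<open>op_cong\<close>.\<close>

definition pos_op :: "(('a \<Rightarrow> real) \<Rightarrow> 'a \<Rightarrow> real) \<Rightarrow> bool" where
  "pos_op A \<longleftrightarrow> (\<forall>f. E f \<longrightarrow> E (A f)) \<and>
     (\<forall>f g. E f \<longrightarrow> E g \<longrightarrow> (AE x in M. A (\<lambda>x. f x + g x) x = A f x + A g x)) \<and>
     (\<forall>c f. E f \<longrightarrow> (AE x in M. A (\<lambda>x. c * f x) x = c * A f x)) \<and>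
     (\<forall>f. E f \<longrightarrow> (AE x in M. 0 \<le> f x) \<longrightarrow> (AE x in M. 0 \<le> A f x)) \<and>
     (\<exists>C. \<forall>f. E f \<longrightarrow> N (A f) \<le> C * N f)"

context
  fixes A assumes A: "pos_op A"
begin

lemma op_E: "E f \<Longrightarrow> E (A f)"
  and op_add: "E f \<Longrightarrow> E g \<Longrightarrow> AE x in M. A (\<lambda>x. f x + g x) x = A f x + A g x"
  and op_cmult: "E f \<Longrightarrow> AE x in M. A (\<lambda>x. c * f x) x = c * A f x"
  and op_pos: "E f \<Longrightarrow> AE x in M. 0 \<le> f x \<Longrightarrow> AE x in M. 0 \<le> A f x"
  using A unfolding pos_op_def by blast+

lemma op_bounded: obtains C where "0 \<le> C" "\<And>f. E f \<Longrightarrow> N (A f) \<le> C * N f"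
proof -
  obtain C where C: "\<And>f. E f \<Longrightarrow> N (A f) \<le> C * N f"
    using A unfolding pos_op_def by blast
  have "N (A f) \<le> max C 0 * N f" if "E f" for f
    using C[OF that] N_nonneg[of f] by (meson max.cobounded1 mult_right_mono order_trans)
  then show ?thesis by (intro that[of "max C 0"]) auto
qed

lemma op_diff:
  assumes "E f" "E g" shows "AE x in M. A (\<lambda>x. f x - g x) x = A f x - A g x"
  using op_add[OF assms(1) E_cmult[OF assms(2), of "-1"]] op_cmult[OF assms(2), of "-1"]
  by eventually_elim simp

lemma op_mono:
  assumes "E f" "E g" "AE x in M. f x \<le> g x" shows "AE x in M. A f x \<le> A g x"
proof -
  have "AE x in M. 0 \<le> A (\<lambda>x. g x - f x) x"
    using assms by (intro op_pos E_diff) auto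
  then show ?thesis using op_diff[OF assms(2,1)] by eventually_elim simp
qed

lemma op_cong:
  assumes "E f" "E g" "AE x in M. f x = g x" shows "AE x in M. A f x = A g x"
proof -
  have "AE x in M. A f x \<le> A g x" "AE x in M. A g x \<le> A f x"
    by (intro op_mono assms eventually_mono[OF assms(3)]; simp)+
  then show ?thesis by eventually_elim simp
qed

lemma op_abs:
  assumes "E f" shows "AE x in M. \<bar>A f x\<bar> \<le> A (\<lambda>x. \<bar>f x\<bar>) x"
proof -
  have "AE x in M. A f x \<le> A (\<lambda>x. \<bar>f x\<bar>) x"
    by (rule op_mono[OF assms E_abs[OF assms]]) auto
  moreover have "AE x in M. A (\<lambda>x. -1 * f x) x \<le> A (\<lambda>x. \<bar>f x\<bar>) x"
    by (rule op_mono[OF E_cmult[OF assms] E_abs[OF assms]]) auto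
  ultimately show ?thesis using op_cmult[OF assms, of "-1"] by eventually_elim auto
qed

lemma op_zero: "AE x in M. A (\<lambda>x. 0) x = 0"
  using op_cmult[OF E_const, of 0 0] by simp

lemma op_sum:
  assumes "\<And>i. i \<in> I \<Longrightarrow> E (f i)"
  shows "AE x in M. A (\<lambda>x. \<Sum>i\<in>I. f i x) x = (\<Sum>i\<in>I. A (f i) x)"
  using assms
proof (induction I rule: infinite_finite_induct)
  case (insert i I)
  then have "AE x in M. A (\<lambda>x. f i x + (\<Sum>i\<in>I. f i x)) x = A (f i) x + A (\<lambda>x. \<Sum>i\<in>I. f i x) x"
    by (intro op_add E_sum) auto
  moreover have "AE x in M. A (\<lambda>x. \<Sum>i\<in>I. f i x) x = (\<Sum>i\<in>I. A (f i) x)"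
    using insert by auto
  ultimately show ?case by eventually_elim (use insert in auto)
qed (simp_all add: op_zero)

lemma op_N_diff:
  assumes "E f" "E g" shows "N (\<lambda>x. A f x - A g x) = N (A (\<lambda>x. f x - g x))"
  using op_diff[OF assms] assms by (intro N_cong E_diff op_E) (auto elim: eventually_mono)

lemma op_N_mono:
  assumes "E f" "E g" "AE x in M. \<bar>f x\<bar> \<le> g x" shows "N (A f) \<le> N (A g)"
proof (rule N_mono)
  have "AE x in M. A (\<lambda>x. \<bar>f x\<bar>) x \<le> A g x"
    using assms by (intro op_mono E_abs)
  with op_abs[OF assms(1)] show "AE x in M. \<bar>A f x\<bar> \<le> \<bar>A g x\<bar>" by eventually_elim auto
qed (auto intro: op_E assms)

end

lemma pos_op_comp:
  assumes A: "pos_op A" and B: "pos_op B" shows "pos_op (A \<circ> B)"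
  unfolding pos_op_def comp_def
proof (intro conjI allI impI)
  fix f g assume f: "E f"
  show "E (A (B f))" by (intro op_E[OF A] op_E[OF B] f)
  show "AE x in M. A (B (\<lambda>x. f x + g x)) x = A (B f) x + A (B g) x" if "E g"
    using op_cong[OF A op_E[OF B E_add[OF f that]] E_add[OF op_E[OF B f] op_E[OF B that]] op_add[OF B f that]]
      op_add[OF A op_E[OF B f] op_E[OF B that]]
    by eventually_elim simp
  show "AE x in M. A (B (\<lambda>x. c * f x)) x = c * A (B f) x" for c
    using op_cong[OF A op_E[OF B E_cmult[OF f]] E_cmult[OF op_E[OF B f]] op_cmult[OF B f, of c]]
      op_cmult[OF A op_E[OF B f], of c]
    by eventually_elim simp
  show "AE x in M. 0 \<le> A (B f) x" if "AE x in M. 0 \<le> f x"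
    by (intro op_pos[OF A] op_E[OF B] op_pos[OF B] f that)
next
  obtain C where C: "0 \<le> C" "\<And>f. E f \<Longrightarrow> N (A f) \<le> C * N f" using op_bounded[OF A] by metis
  obtain D where D: "0 \<le> D" "\<And>f. E f \<Longrightarrow> N (B f) \<le> D * N f" using op_bounded[OF B] by metis
  have "N (A (B f)) \<le> (C * D) * N f" if "E f" for f
    using order_trans[OF C(2)[OF op_E[OF B that]] mult_left_mono[OF D(2)[OF that] C(1)]]
    by (simp add: mult.assoc)
  then show "\<exists>C. \<forall>f. E f \<longrightarrow> N (A (B f)) \<le> C * N f" by blast
qed

lemma pos_op_id: "pos_op id"
  unfolding pos_op_def by (auto intro!: exI[of _ 1])

lemma pos_op_funpow: "pos_op A \<Longrightarrow> pos_op (A ^^ n)"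
  by (induction n) (simp_all add: pos_op_id[unfolded id_def] pos_op_id pos_op_comp)

section \<open>Operator norms and the effect of compactness\<close>

definition opn :: "(('a \<Rightarrow> real) \<Rightarrow> 'a \<Rightarrow> real) \<Rightarrow> real" where
  "opn A = (SUP f\<in>{f. E f \<and> N f \<le> 1}. N (A f))"

lemma opn_least:
  assumes "\<And>f. E f \<Longrightarrow> N f \<le> 1 \<Longrightarrow> N (A f) \<le> c" shows "opn A \<le> c"
  unfolding opn_def
proof (rule cSUP_least)
  show "{f. E f \<and> N f \<le> 1} \<noteq> {}" using E_const[of 0] N_const[of 0] by auto
qed (use assms in auto)

lemma opn_upper_unit:
  assumes A: "pos_op A" and "E f" "N f \<le> 1" shows "N (A f) \<le> opn A"
  unfolding opn_def
proof (rule cSUP_upper)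
  obtain C where C: "0 \<le> C" "\<And>f. E f \<Longrightarrow> N (A f) \<le> C * N f" using op_bounded[OF A] by metis
  have "N (A f) \<le> C" if "E f" "N f \<le> 1" for f
    using C(2)[OF that(1)] mult_left_mono[OF that(2) C(1)] by simp
  then show "bdd_above ((\<lambda>f. N (A f)) ` {f. E f \<and> N f \<le> 1})" by (auto intro!: bdd_aboveI2)
qed (use assms in auto)

lemma opn_nonneg: "pos_op A \<Longrightarrow> 0 \<le> opn A"
  using opn_upper_unit[of A "\<lambda>_. 0"] N_nonneg[of "A (\<lambda>_. 0)"] by (simp add: E_const N_const)

text \<open>Scaling into the unit ball fails when N f = 0; there boundedness of A gives N (A f) = 0
  directly.\<close>

lemma opn_upper:
  assumes A: "pos_op A" and f: "E f" shows "N (A f) \<le> opn A * N f"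
proof (cases "N f = 0")
  case True
  obtain C where "0 \<le> C" "\<And>f. E f \<Longrightarrow> N (A f) \<le> C * N f" using op_bounded[OF A] by metis
  from this(2)[OF f] True show ?thesis by simp
next
  case False
  then have pos: "N f > 0" using N_nonneg[of f] by simp
  have "N (A (\<lambda>x. inverse (N f) * f x)) \<le> opn A"
    using pos f by (intro opn_upper_unit A E_cmult) (auto simp: N_cmult)
  moreover have "N (A (\<lambda>x. inverse (N f) * f x)) = N (\<lambda>x. inverse (N f) * A f x)"
    using f by (intro N_cong op_cmult[OF A] op_E[OF A] E_cmult)
  ultimately have "inverse (N f) * N (A f) \<le> opn A" using pos by (simp only: N_cmult) simp
  then show ?thesis using pos by (simp add: field_simps)
qed

lemma opn_comp:
  assumes A: "pos_op A" and B: "pos_op B" shows "opn (A \<circ> B) \<le> opn A * opn B"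
proof (rule opn_least)
  fix f assume f: "E f" "N f \<le> 1"
  have "N (A (B f)) \<le> opn A * N (B f)" by (intro opn_upper A op_E[OF B] f)
  also have "\<dots> \<le> opn A * opn B" by (intro mult_left_mono opn_upper_unit opn_nonneg A B f)
  finally show "N ((A \<circ> B) f) \<le> opn A * opn B" by simp
qed

lemma compact_comp:
  assumes A: "pos_op A" and B: "compact_on_Lp p M B" "pos_op B"
  shows "compact_on_Lp p M (A \<circ> B)"
  unfolding compact_on_Lp_def
proof (intro allI impI)
  fix hs :: "nat \<Rightarrow> 'a \<Rightarrow> real"
  assume hs: "\<forall>k. E (hs k) \<and> N (hs k) \<le> 1"
  then obtain r f where rf: "strict_mono r" "E f" "(\<lambda>k. N (\<lambda>x. B (hs (r k)) x - f x)) \<longlonglongrightarrow> 0"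
    using B unfolding compact_on_Lp_def by blast
  have "(\<lambda>k. N (\<lambda>x. (A \<circ> B) (hs (r k)) x - A f x)) \<longlonglongrightarrow> 0"
  proof (rule Lim_null_comparison)
    show "\<forall>\<^sub>F k in sequentially. norm (N (\<lambda>x. (A \<circ> B) (hs (r k)) x - A f x)) \<le> opn A * N (\<lambda>x. B (hs (r k)) x - f x)"
    proof (rule always_eventually, rule allI)
      fix k
      have "E (B (hs (r k)))" using hs by (intro op_E[OF B(2)]) auto
      then show "norm (N (\<lambda>x. (A \<circ> B) (hs (r k)) x - A f x)) \<le> opn A * N (\<lambda>x. B (hs (r k)) x - f x)"
        using A rf(2) opn_upper[OF A] by (auto simp: op_N_diff N_nonneg E_diff)
    qed
    show "(\<lambda>k. opn A * N (\<lambda>x. B (hs (r k)) x - f x)) \<longlonglongrightarrow> 0"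
      using tendsto_mult_left[OF rf(3), of "opn A"] by simp
  qed
  then show "\<exists>r f. strict_mono r \<and> E f \<and> (\<lambda>k. N (\<lambda>x. (A \<circ> B) (hs (r k)) x - f x)) \<longlonglongrightarrow> 0"
    using rf A op_E by blast
qed

text \<open>The compact image of the unit ball is, up to \<open>\<epsilon>\<close>, dominated by a single multiple of any
  a.e. positive \<open>q\<close>; this plays the role of a quasi-interior point.\<close>

lemma compact_dominated:
  assumes K: "pos_op K" "compact_on_Lp p M K" and q: "E q" "AE x in M. 0 < q x" and "0 < \<epsilon>"
  obtains m where "0 < m" "\<And>f. E f \<Longrightarrow> N f \<le> 1 \<Longrightarrow> N (\<lambda>x. max (\<bar>K f x\<bar> - m * q x) 0) \<le> \<epsilon>"
proof (rule ccontr)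
  assume "\<not> thesis"
  then have "\<forall>m. \<exists>f. m > 0 \<longrightarrow> E f \<and> N f \<le> 1 \<and> N (\<lambda>x. max (\<bar>K f x\<bar> - m * q x) 0) > \<epsilon>"
    using that by (meson not_le)
  then obtain F where F: "\<And>m. m > 0 \<Longrightarrow> E (F m) \<and> N (F m) \<le> 1 \<and> N (\<lambda>x. max (\<bar>K (F m) x\<bar> - m * q x) 0) > \<epsilon>"
    by metis
  \<comment> \<open>\<open>F\<close> is controlled only at positive arguments, hence the shift to
    \<open>Suc k\<close>.\<close>
  define hs where "hs k = F (real (Suc k))" for k
  have hs: "E (hs k)" "N (hs k) \<le> 1" "N (\<lambda>x. max (\<bar>K (hs k) x\<bar> - real (Suc k) * q x) 0) > \<epsilon>" for k
    using F[of "real (Suc k)"] by (auto simp: hs_def)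
  then obtain r g where rg: "strict_mono r" "E g" "(\<lambda>k. N (\<lambda>x. K (hs (r k)) x - g x)) \<longlonglongrightarrow> 0"
    using K(2) unfolding compact_on_Lp_def by blast
  have EK: "E (K (hs k))" for k using hs by (intro op_E[OF K(1)])
  have Er: "E (\<lambda>x. max (\<bar>g x\<bar> - real k * q x) 0)" for k
    using rg q by (intro E_max E_diff E_abs E_cmult E_const)
  have "(\<lambda>k. N (\<lambda>x. max (\<bar>g x\<bar> - real k * q x) 0)) \<longlonglongrightarrow> 0"
  proof (rule N_dominated_tendsto_0[OF Er rg(2)])
    show "AE x in M. \<bar>max (\<bar>g x\<bar> - real n * q x) 0\<bar> \<le> \<bar>g x\<bar>" for n
      using q(2) by eventually_elim auto
    show "AE x in M. (\<lambda>n. max (\<bar>g x\<bar> - real n * q x) 0) \<longlonglongrightarrow> 0"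
      using q(2)
    proof eventually_elim
      case (elim x)
      \<comment> \<open>Here strict positivity of q enters: at almost every point n q eventually
        exceeds |g|, so the excess vanishes.\<close>
      obtain n0 :: nat where n0: "real n0 > \<bar>g x\<bar> / q x" using reals_Archimedean2 by blast
      have "max (\<bar>g x\<bar> - real n * q x) 0 = 0" if "n \<ge> n0" for n
      proof -
        have "\<bar>g x\<bar> / q x \<le> real n" using n0 that by linarith
        then show ?thesis using elim by (simp add: pos_divide_le_eq)
      qed
      then show ?case by (intro tendsto_eventually) (auto simp: eventually_sequentially)
    qed
  qed
  then have "(\<lambda>k. N (\<lambda>x. K (hs (r k)) x - g x) + N (\<lambda>x. max (\<bar>g x\<bar> - real k * q x) 0)) \<longlonglongrightarrow> 0 + 0"
    by (intro tendsto_add rg)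
  then have "\<forall>\<^sub>F k in sequentially. N (\<lambda>x. K (hs (r k)) x - g x) + N (\<lambda>x. max (\<bar>g x\<bar> - real k * q x) 0) < \<epsilon>"
    using \<open>0 < \<epsilon>\<close> by (intro order_tendstoD) auto
  then obtain k where k: "N (\<lambda>x. K (hs (r k)) x - g x) + N (\<lambda>x. max (\<bar>g x\<bar> - real k * q x) 0) < \<epsilon>"
    by (auto simp: eventually_sequentially)
  \<comment> \<open>Since r k \<ge> k, the excess of |K (hs (r k))| over its own multiple of q is at
    most its distance to g plus the excess of |g| over k q. Both are small, against the choice of
    \<open>F\<close>.\<close>
  have "N (\<lambda>x. max (\<bar>K (hs (r k)) x\<bar> - real (Suc (r k)) * q x) 0)
        \<le> N (\<lambda>x. \<bar>K (hs (r k)) x - g x\<bar> + max (\<bar>g x\<bar> - real k * q x) 0)"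
  proof (rule N_mono)
    show "E (\<lambda>x. max (\<bar>K (hs (r k)) x\<bar> - real (Suc (r k)) * q x) 0)"
      using q EK by (intro E_max E_diff E_abs E_cmult E_const)
    show "E (\<lambda>x. \<bar>K (hs (r k)) x - g x\<bar> + max (\<bar>g x\<bar> - real k * q x) 0)"
      using EK rg by (intro E_add E_abs E_diff Er)
    show "AE x in M. \<bar>max (\<bar>K (hs (r k)) x\<bar> - real (Suc (r k)) * q x) 0\<bar>
           \<le> \<bar>\<bar>K (hs (r k)) x - g x\<bar> + max (\<bar>g x\<bar> - real k * q x) 0\<bar>"
      using q(2)
    proof eventually_elim
      case (elim x)
      have "real k * q x \<le> real (Suc (r k)) * q x"
        using elim seq_suble[OF rg(1), of k] by (intro mult_right_mono) auto
      then show ?case by linarith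
    qed
  qed
  also have "\<dots> \<le> N (\<lambda>x. K (hs (r k)) x - g x) + N (\<lambda>x. max (\<bar>g x\<bar> - real k * q x) 0)"
    using N_add[OF E_abs[OF E_diff[OF EK rg(2)]] Er] by (simp add: N_abs)
  finally show False using k hs(3)[of "r k"] by simp
qed

text \<open>With \<open>A = V\<^sup>n\<close> and \<open>K = V\<^sup>i\<close> this compares operator norms of powers with the
  orbit of a single function.\<close>

lemma compact_opn_le:
  assumes K: "pos_op K" "compact_on_Lp p M K" and q: "E q" "AE x in M. 0 < q x" and "0 < \<epsilon>"
  obtains m where "0 < m" "\<And>A. pos_op A \<Longrightarrow> opn (A \<circ> K) \<le> m * N (A q) + \<epsilon> * opn A"
proof -
  obtain m where m: "0 < m" "\<And>f. E f \<Longrightarrow> N f \<le> 1 \<Longrightarrow> N (\<lambda>x. max (\<bar>K f x\<bar> - m * q x) 0) \<le> \<epsilon>"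
    using compact_dominated[OF assms] by metis
  have "opn (A \<circ> K) \<le> m * N (A q) + \<epsilon> * opn A" if A: "pos_op A" for A
  proof (rule opn_least)
    fix f assume f: "E f" "N f \<le> 1"
    \<comment> \<open>The excess has norm at most \<epsilon>, and |K f| \<le> m q + e; positivity of
      A then allows the two terms to be estimated separately.\<close>
    let ?e = "\<lambda>x. max (\<bar>K f x\<bar> - m * q x) 0"
    have Ee: "E ?e" using q f K by (intro E_max E_diff E_abs E_cmult E_const op_E[OF K(1)])
    have Emq: "E (\<lambda>x. m * q x)" using q by (intro E_cmult)
    have "N (A (K f)) \<le> N (A (\<lambda>x. m * q x + ?e x))"
      using K f q Ee Emq by (intro op_N_mono[OF A] op_E[OF K(1)] E_add) auto
    also have "\<dots> = N (\<lambda>x. A (\<lambda>x. m * q x) x + A ?e x)"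
      using Ee Emq by (intro N_cong op_add[OF A] op_E[OF A] E_add)
    also have "\<dots> \<le> N (A (\<lambda>x. m * q x)) + N (A ?e)"
      using Ee Emq by (intro N_add op_E[OF A])
    also have "\<dots> \<le> m * N (A q) + opn A * \<epsilon>"
    proof (rule add_mono)
      have "N (A (\<lambda>x. m * q x)) = N (\<lambda>x. m * A q x)"
        using q by (intro N_cong op_cmult[OF A] op_E[OF A] E_cmult)
      then show "N (A (\<lambda>x. m * q x)) \<le> m * N (A q)" using m(1) by (simp add: N_cmult)
      have "N (A ?e) \<le> opn A * N ?e" by (rule opn_upper[OF A Ee])
      also have "\<dots> \<le> opn A * \<epsilon>" using m(2) f opn_nonneg[OF A] by (intro mult_left_mono) auto
      finally show "N (A ?e) \<le> opn A * \<epsilon>" .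
    qed
    finally show "N ((A \<circ> K) f) \<le> m * N (A q) + \<epsilon> * opn A" by (simp add: mult.commute)
  qed
  with m(1) show ?thesis by (rule that)
qed

end

subsection \<open>Growth rates of sequences\<close>

text \<open>Fekete's lemma: the limit is the infimum of x n / n, which the linear lower bound keeps
  finite.\<close>

lemma subadditive_limit:
  fixes x :: "nat \<Rightarrow> real"
  assumes sub: "\<And>m n. x (m + n) \<le> x m + x n" and low: "\<And>n. - C * real n \<le> x n"
  obtains l where "(\<lambda>n. x n / real n) \<longlonglongrightarrow> l" "\<And>n. l * real n \<le> x n"
proof -
  define A where "A = (\<lambda>n. x n / real n) ` {1..}"
  define l where "l = Inf A"
  have "bdd_below A"
  proof (rule bdd_belowI[of _ "- C"])
    fix y assume "y \<in> A"
    then obtain n where "n \<ge> 1" "y = x n / real n" by (auto simp: A_def)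
    then show "- C \<le> y" using low[of n] by (simp add: pos_le_divide_eq)
  qed
  then have le: "l \<le> x n / real n" if "n \<ge> 1" for n
    unfolding l_def by (rule cInf_lower[rotated]) (use that in \<open>auto simp: A_def\<close>)
  have le': "l * real n \<le> x n" for n
  proof (cases "n = 0")
    case True then show ?thesis using sub[of 0 0] by simp
  next
    case False then show ?thesis using le[of n] by (simp add: pos_le_divide_eq)
  qed
  have "(\<lambda>n. x n / real n) \<longlonglongrightarrow> l"
  proof (rule order_tendstoI)
    fix a assume "a < l"
    show "\<forall>\<^sub>F n in sequentially. a < x n / real n"
      using eventually_ge_at_top[of 1] by eventually_elim (use le \<open>a < l\<close> in \<open>force intro: less_le_trans\<close>)
  next
    fix a assume "l < a"
    moreover have "A \<noteq> {}" by (auto simp: A_def)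
    ultimately obtain y where "y \<in> A" "y < a" unfolding l_def using cInf_lessD by blast
    then obtain m where m: "m \<ge> 1" "y = x m / real m" by (auto simp: A_def)
    define D where "D = (\<Sum>r<m. \<bar>x r\<bar>)"
    have D: "x r \<le> D" if "r < m" for r
    proof -
      have "\<bar>x r\<bar> \<le> D" unfolding D_def by (rule member_le_sum) (use that in auto)
      then show ?thesis by simp
    qed
    have mult: "x (q * m + r) \<le> real q * x m + x r" for q r
    proof (induction q)
      case (Suc q)
      have "x (Suc q * m + r) \<le> x m + x (q * m + r)" using sub[of m "q * m + r"] by (simp add: add.assoc)
      then show ?case using Suc by (simp add: algebra_simps)
    qed simp
    \<comment> \<open>Write n = q m + r with r < m. Subadditivity gives q x m + x r; replacing q m
      by n costs at most m |y|, and x r at most D, both independent of n.\<close>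
    have bound: "x n / real n \<le> y + (real m * \<bar>y\<bar> + D) / real n" if "n \<ge> 1" for n
    proof -
      let ?q = "n div m" and ?r = "n mod m"
      have "x n \<le> real ?q * x m + x ?r" using mult[of ?q ?r] by simp
      also have "x ?r \<le> D" using m by (intro D) auto
      also have "real ?q * x m = real (?q * m) * y" using m by simp
      also have "real (?q * m) = real n - real ?r"
        by (metis add_diff_cancel_right' div_mult_mod_eq of_nat_add)
      also have "(real n - real ?r) * y \<le> real n * y + real m * \<bar>y\<bar>"
      proof -
        have "- (real ?r * y) \<le> real ?r * \<bar>y\<bar>" using mult_left_mono[of "- y" "\<bar>y\<bar>" "real ?r"] by simp
        also have "\<dots> \<le> real m * \<bar>y\<bar>" using m by (intro mult_right_mono) (auto intro!: less_imp_le)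
        finally show ?thesis by (simp add: algebra_simps)
      qed
      finally have "x n \<le> real n * y + (real m * \<bar>y\<bar> + D)" by simp
      then show ?thesis using that by (simp add: field_simps)
    qed
    have "(\<lambda>n. y + (real m * \<bar>y\<bar> + D) / real n) \<longlonglongrightarrow> y + 0"
      by (intro tendsto_add tendsto_const lim_const_over_n)
    then have "\<forall>\<^sub>F n in sequentially. y + (real m * \<bar>y\<bar> + D) / real n < a"
      using \<open>y < a\<close> by (intro order_tendstoD) auto
    then show "\<forall>\<^sub>F n in sequentially. x n / real n < a"
      using eventually_ge_at_top[of 1] by eventually_elim (use bound in \<open>force intro: le_less_trans\<close>)
  qed
  with le' show ?thesis using that by blast
qed

text \<open>If \<open>\<beta>\<close> halves along \<open>n, n + i, n + 2 i, \<dots>\<close> up to an error \<open>m \<cdot> \<alpha>\<close>, then, as it stays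
  above \<open>1\<close>, the error must take over after about \<open>log\<^sub>2 (\<beta> n)\<close> steps, during which \<open>\<alpha>\<close> grows
  by at most a power of \<open>\<beta> n\<close>.\<close>

lemma polynomial_lower_bound:
  fixes \<alpha> \<beta> :: "nat \<Rightarrow> real"
  assumes \<beta>: "\<And>n. 1 \<le> \<beta> n" and \<alpha>: "\<And>n. 0 \<le> \<alpha> n"
    and rec\<beta>: "\<And>n. \<beta> (n + i) \<le> m * \<alpha> n + \<beta> n / 2"
    and rec\<alpha>: "\<And>n. \<alpha> (n + i) \<le> D * \<alpha> n" and D: "1 \<le> D" and m: "0 < m"
  obtains c s where "0 < c" "\<And>n. c \<le> \<alpha> n * \<beta> n ^ s"
proof -
  \<comment> \<open>This yields (2 D)^l \<le> (2^l)^s. With l chosen below so that 2^l is comparable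
    to \<beta> n, exponential growth in l becomes a power of \<beta> n.\<close>
  obtain s :: nat where s: "2 * D < 2 ^ s" using real_arch_pow[of 2 "2 * D"] by auto
  have \<alpha>l: "\<alpha> (n + l * i) \<le> D ^ l * \<alpha> n" for n l
  proof (induction l)
    case (Suc l)
    have "\<alpha> (n + Suc l * i) \<le> D * \<alpha> (n + l * i)" using rec\<alpha>[of "n + l * i"] by (simp add: ac_simps)
    also have "\<dots> \<le> D * (D ^ l * \<alpha> n)" using D Suc by (intro mult_left_mono) auto
    finally show ?case by simp
  qed simp
  have \<beta>l: "\<beta> (n + l * i) \<le> \<beta> n / 2 ^ l + m * (2 * D) ^ l * \<alpha> n" for n l
  proof (induction l)
    case 0 show ?case using m \<alpha>[of n] by simp
  next
    case (Suc l)
    have "\<beta> (n + Suc l * i) \<le> m * \<alpha> (n + l * i) + \<beta> (n + l * i) / 2"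
      using rec\<beta>[of "n + l * i"] by (simp add: ac_simps)
    \<comment> \<open>D^l is weakened to (2 D)^l so that both errors have the same form. Together
      they carry the factor 3/2, which is absorbed by one further factor 2 D \<ge> 2.\<close>
    also have "\<dots> \<le> m * ((2 * D) ^ l * \<alpha> n) + (\<beta> n / 2 ^ l + m * (2 * D) ^ l * \<alpha> n) / 2"
    proof -
      have "\<alpha> (n + l * i) \<le> D ^ l * \<alpha> n" by (rule \<alpha>l)
      also have "\<dots> \<le> (2 * D) ^ l * \<alpha> n" using D \<alpha> by (intro mult_right_mono power_mono) auto
      finally have "m * \<alpha> (n + l * i) \<le> m * ((2 * D) ^ l * \<alpha> n)" using m by (intro mult_left_mono) auto
      then show ?thesis using Suc by (intro add_mono divide_right_mono) (assumption | simp)+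
    qed
    also have "\<dots> = \<beta> n / 2 ^ Suc l + m * ((3/2) * (2 * D) ^ l) * \<alpha> n" by (simp add: field_simps)
    also have "\<dots> \<le> \<beta> n / 2 ^ Suc l + m * (2 * D) ^ Suc l * \<alpha> n"
    proof -
      have "(3/2) * (2 * D) ^ l \<le> (2 * D) * (2 * D) ^ l" using D by (intro mult_right_mono) auto
      then show ?thesis using m \<alpha>[of n] by (intro add_mono mult_right_mono mult_left_mono) auto
    qed
    finally show ?case .
  qed
  have "1 / (2 * m * 4 ^ s) \<le> \<alpha> n * \<beta> n ^ s" for n
  proof -
    obtain l0 :: nat where "2 * \<beta> n < 2 ^ l0" using real_arch_pow[of 2 "2 * \<beta> n"] by auto
    then have ex: "\<exists>l::nat. 2 * \<beta> n \<le> 2 ^ l" by (auto intro: less_imp_le)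
    \<comment> \<open>This l makes the halved term at most 1/2; as \<beta> \<ge> 1, the error term
      must be at least 1/2. Minimality gives 2^l \<le> 4 \<beta> n, so the error factor stays a
      power of \<beta> n.\<close>
    define l :: nat where "l = (LEAST l. 2 * \<beta> n \<le> 2 ^ l)"
    have l1: "2 * \<beta> n \<le> 2 ^ l" unfolding l_def by (rule LeastI_ex[OF ex])
    have "l \<noteq> 0" using l1 \<beta>[of n] by (intro notI) simp
    then obtain k where k: "l = Suc k" by (cases l) auto
    then have "\<not> 2 * \<beta> n \<le> 2 ^ k" unfolding l_def by (intro not_less_Least) auto
    then have l2: "2 ^ l \<le> 4 * \<beta> n" using k by simp
    have "1 \<le> \<beta> n / 2 ^ l + m * (2 * D) ^ l * \<alpha> n" using \<beta>[of "n + l * i"] \<beta>l[of n l] by linarith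
    also have "\<beta> n / 2 ^ l \<le> 1 / 2" using l1 by (simp add: field_simps)
    finally have "1 / 2 \<le> m * (2 * D) ^ l * \<alpha> n" by simp
    also have "\<dots> \<le> m * (4 ^ s * \<beta> n ^ s) * \<alpha> n"
    proof (intro mult_right_mono mult_left_mono)
      have "(2 * D) ^ l \<le> (2 ^ s) ^ l" using s D by (intro power_mono) auto
      also have "\<dots> = (2 ^ l) ^ s" by (simp flip: power_mult add: mult.commute)
      also have "\<dots> \<le> (4 * \<beta> n) ^ s" using l2 by (intro power_mono) auto
      finally show "(2 * D) ^ l \<le> 4 ^ s * \<beta> n ^ s" by (simp add: power_mult_distrib)
    qed (use m \<alpha> in auto)
    finally show ?thesis using m by (simp add: field_simps)
  qed
  with m show ?thesis by (intro that[of "1 / (2 * m * 4 ^ s)" s]) auto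
qed

subsection \<open>Irreducible eventually compact positive operators\<close>

text \<open>\<open>irr\<close> is the form in which irreducibility is used. \<open>orbit_pos\<close>
  makes the norms of the orbit of 1, and hence \<open>b n\<close>, positive, so that their
  logarithms are meaningful.\<close>

locale irreducible_op = Lp_space M p for M :: "'a::topological_space measure" and p +
  fixes V :: "('a \<Rightarrow> real) \<Rightarrow> 'a \<Rightarrow> real" and i :: nat
  assumes pos: "pos_op V" and cpt: "compact_on_Lp p M (V ^^ i)" and i: "1 \<le> i"
    and irr: "E f \<Longrightarrow> AE x in M. 0 \<le> f x \<Longrightarrow> \<not> (AE x in M. f x = 0) \<Longrightarrow> AE x in M. \<exists>n. 0 < (V ^^ n) f x"
    and orbit_pos: "0 < N ((V ^^ n) (\<lambda>_. 1))"
begin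

abbreviation b :: "nat \<Rightarrow> real" where "b n \<equiv> opn (V ^^ n)"
abbreviation K :: "('a \<Rightarrow> real) \<Rightarrow> 'a \<Rightarrow> real" where "K \<equiv> V ^^ i"

lemmas pos_pow = pos_op_funpow[OF pos]
lemmas pow_E = op_E[OF pos_pow]

lemma b_le: "E f \<Longrightarrow> N ((V ^^ n) f) \<le> b n * N f"
  by (rule opn_upper[OF pos_pow])

lemma b_nonneg: "0 \<le> b n"
  by (rule opn_nonneg[OF pos_pow])

lemma b_add: "b (m + n) \<le> b m * b n"
  using opn_comp[OF pos_pow pos_pow] by (simp add: funpow_add)

lemma orbit_le_b: "N ((V ^^ n) (\<lambda>_. 1)) \<le> b n"
  using b_le[OF E_const[of 1], of n] by (simp add: N_const)

lemma b_pos: "0 < b n"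
  using orbit_pos[of n] orbit_le_b[of n] by linarith

lemma pow_commute: "(V ^^ m) ((V ^^ n) f) = (V ^^ n) ((V ^^ m) f)"
  by (metis add.commute comp_apply funpow_add)

lemma b_power: "b (k * n) \<le> b n ^ k" if "1 \<le> k"
  using that
proof (induction k rule: dec_induct)
  case (step k)
  have "b (n + k * n) \<le> b n * b (k * n)" by (rule b_add)
  also have "\<dots> \<le> b n * b n ^ k" using step b_nonneg by (intro mult_left_mono) auto
  finally show ?case by simp
qed simp

text \<open>The single index l controls both the number of summands and the weight in front. For
  nonnegative f this makes \<open>Z l f\<close> increasing in l, and unbounded wherever some V^n f
  is positive. \<open>z l\<close> bounds its norm.\<close>

definition Z :: "nat \<Rightarrow> ('a \<Rightarrow> real) \<Rightarrow> 'a \<Rightarrow> real" where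
  "Z l f x = real l * (\<Sum>n<l. (V ^^ n) f x)"

definition z :: "nat \<Rightarrow> real" where
  "z l = real l * (\<Sum>n<l. b n)"

lemma E_Z: "E f \<Longrightarrow> E (Z l f)"
  unfolding Z_def by (intro E_cmult E_sum pow_E)

lemma z_nonneg: "0 \<le> z l"
  unfolding z_def by (intro mult_nonneg_nonneg sum_nonneg b_nonneg) auto

lemma N_Z_le: assumes "E f" shows "N (Z l f) \<le> z l * N f"
proof -
  have "N (Z l f) = real l * N (\<lambda>x. \<Sum>n<l. (V ^^ n) f x)"
    unfolding Z_def by (simp add: N_cmult)
  also have "\<dots> \<le> real l * (\<Sum>n<l. b n * N f)"
    using assms by (intro mult_left_mono order_trans[OF N_sum] sum_mono b_le pow_E) auto
  finally show ?thesis by (simp add: z_def sum_distrib_right mult.assoc)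
qed

lemma Z_diff: assumes "E f" "E g" shows "AE x in M. Z l (\<lambda>x. f x - g x) x = Z l f x - Z l g x"
proof -
  have "AE x in M. \<forall>n. (V ^^ n) (\<lambda>x. f x - g x) x = (V ^^ n) f x - (V ^^ n) g x"
    using op_diff[OF pos_pow assms] by (simp add: AE_all_countable)
  then show ?thesis
    by eventually_elim (simp add: Z_def sum_subtractf right_diff_distrib)
qed

lemma pow_Z: assumes "E f" shows "AE x in M. (V ^^ m) (Z l f) x = Z l ((V ^^ m) f) x"
proof -
  have "E (\<lambda>x. \<Sum>n<l. (V ^^ n) f x)" using assms by (intro E_sum pow_E)
  from op_cmult[OF pos_pow this, of m "real l"]
  have "AE x in M. (V ^^ m) (Z l f) x = real l * (V ^^ m) (\<lambda>x. \<Sum>n<l. (V ^^ n) f x) x"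
    by (simp add: Z_def[abs_def])
  moreover have "AE x in M. (V ^^ m) (\<lambda>x. \<Sum>n<l. (V ^^ n) f x) x = (\<Sum>n<l. (V ^^ m) ((V ^^ n) f) x)"
    using assms by (intro op_sum[OF pos_pow] pow_E)
  ultimately show ?thesis
    by eventually_elim (simp add: Z_def pow_commute[of m])
qed

text \<open>On the order interval \<open>[0, 1]\<close> consider the set \<open>B\<close> of functions within \<open>\<rho>\<close> of \<open>1\<close>.
  As \<open>K B\<close> is relatively compact and bounded away from \<open>0\<close>, irreducibility gives an \<open>l\<close> such that
  \<open>f \<mapsto> min 1 (Z l (K f))\<close> maps \<open>B\<close> to itself. This replaces the use of an invariant
  subspace theorem in showing that the spectral radius is positive.\<close>

lemma invariant_ball:
  obtains \<rho> l where "0 < \<rho>" "\<rho> \<le> 1/2"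
    "\<And>f. E f \<Longrightarrow> AE x in M. 0 \<le> f x \<and> f x \<le> 1 \<Longrightarrow> N (\<lambda>x. 1 - f x) \<le> \<rho> \<Longrightarrow> N (\<lambda>x. 1 - min 1 (Z l (K f) x)) \<le> \<rho>"
proof -
  define \<kappa> where "\<kappa> = N (K (\<lambda>_. 1))"
  have \<kappa>: "\<kappa> > 0" unfolding \<kappa>_def by (rule orbit_pos)
  \<comment> \<open>For f within \<rho> of 1 the second bound gives N (K f) \<ge> \<kappa> - b i *
    \<rho> \<ge> \<kappa>/2. The bound 1/2 keeps the norm of f itself at least 1/2, as needed in
    \<open>b_lower\<close>.\<close>
  define \<rho> where "\<rho> = min (1/2) (\<kappa> / (2 * b i))"
  have \<rho>: "\<rho> > 0" "\<rho> \<le> 1/2" "b i * \<rho> \<le> \<kappa> / 2"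
  proof -
    show "\<rho> > 0" "\<rho> \<le> 1/2" using \<kappa> b_pos[of i] by (auto simp: \<rho>_def)
    have "b i * \<rho> \<le> b i * (\<kappa> / (2 * b i))" unfolding \<rho>_def by (intro mult_left_mono b_nonneg) auto
    then show "b i * \<rho> \<le> \<kappa> / 2" using b_pos[of i] by simp
  qed
  have "\<exists>l. \<forall>f. E f \<longrightarrow> (AE x in M. 0 \<le> f x \<and> f x \<le> 1) \<longrightarrow> N (\<lambda>x. 1 - f x) \<le> \<rho> \<longrightarrow> N (\<lambda>x. 1 - min 1 (Z l (K f) x)) \<le> \<rho>"
  proof (rule ccontr)
    assume "\<not> ?thesis"
    then have "\<forall>l. \<exists>f. E f \<and> (AE x in M. 0 \<le> f x \<and> f x \<le> 1) \<and> N (\<lambda>x. 1 - f x) \<le> \<rho> \<and> N (\<lambda>x. 1 - min 1 (Z l (K f) x)) > \<rho>"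
      by (simp add: not_le)
    from choice[OF this] obtain F where F: "\<And>l. E (F l)" "\<And>l. AE x in M. 0 \<le> F l x \<and> F l x \<le> 1"
      "\<And>l. N (\<lambda>x. 1 - F l x) \<le> \<rho>" "\<And>l. N (\<lambda>x. 1 - min 1 (Z l (K (F l)) x)) > \<rho>"
      by blast
    have EK: "E (K (F l))" for l by (rule pow_E[OF F(1)])
    have Kpos: "AE x in M. 0 \<le> K (F l) x" for l
      using op_pos[OF pos_pow F(1)[of l]] F(2)[of l] by (auto elim: eventually_mono)
    have "N (F l) \<le> 1" for l
    proof -
      have "AE x in M. \<bar>F l x\<bar> \<le> \<bar>1\<bar>" using F(2)[of l] by eventually_elim auto
      then show ?thesis using N_mono[OF F(1) E_const[of 1], of l] by (simp add: N_const)
    qed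
    with F(1) obtain r g0 where rg: "strict_mono r" "E g0" "(\<lambda>k. N (\<lambda>x. K (F (r k)) x - g0 x)) \<longlonglongrightarrow> 0"
      using cpt unfolding compact_on_Lp_def by blast
    \<comment> \<open>\<open>irr\<close> asks for a nonnegative function. Cutting off the negative
      part of the limit does not increase its distance to the nonnegative functions
      \<open>K (F l)\<close>.\<close>
    define g where "g x = max (g0 x) 0" for x
    have Eg: "E g" unfolding g_def by (intro E_max E_const rg)
    have gpos: "AE x in M. 0 \<le> g x" by (auto simp: g_def)
    have lim: "(\<lambda>k. N (\<lambda>x. K (F (r k)) x - g x)) \<longlonglongrightarrow> 0"
    proof (rule tendsto_sandwich[OF _ _ tendsto_const rg(3)])
      show "\<forall>\<^sub>F k in sequentially. N (\<lambda>x. K (F (r k)) x - g x) \<le> N (\<lambda>x. K (F (r k)) x - g0 x)"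
      proof (rule always_eventually, rule allI, rule N_mono)
        fix k
        show "AE x in M. \<bar>K (F (r k)) x - g x\<bar> \<le> \<bar>K (F (r k)) x - g0 x\<bar>"
          using Kpos[of "r k"] by eventually_elim (auto simp: g_def)
      qed (intro E_diff EK Eg rg)+
    qed (simp add: N_nonneg)
    have Klow: "\<kappa> / 2 \<le> N (K (F l))" for l
    proof -
      have "\<kappa> \<le> N (K (F l)) + N (\<lambda>x. K (\<lambda>_. 1) x - K (F l) x)"
        unfolding \<kappa>_def by (intro N_reverse pow_E E_const F)
      also have "N (\<lambda>x. K (\<lambda>_. 1) x - K (F l) x) = N (K (\<lambda>x. 1 - F l x))"
        by (intro op_N_diff[OF pos_pow] E_const F)
      finally have "\<kappa> \<le> N (K (F l)) + N (K (\<lambda>x. 1 - F l x))" .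
      moreover have "N (K (\<lambda>x. 1 - F l x)) \<le> b i * \<rho>"
        using b_le[OF E_diff[OF E_const F(1)], of i 1 l] mult_left_mono[OF F(3)[of l] b_nonneg[of i]] by linarith
      ultimately show ?thesis using \<rho>(3) by linarith
    qed
    \<comment> \<open>The uniform bound N (K (F l)) \<ge> \<kappa>/2 survives in the norm
      limit.\<close>
    have "\<not> (AE x in M. g x = 0)"
    proof
      assume "AE x in M. g x = 0"
      then have "N g = 0" using N_eq_0_iff[OF Eg] by simp
      have "\<forall>\<^sub>F k in sequentially. N (\<lambda>x. K (F (r k)) x - g x) < \<kappa> / 2"
        using lim \<kappa> by (intro order_tendstoD) auto
      then obtain k where "N (\<lambda>x. K (F (r k)) x - g x) < \<kappa> / 2" by (auto simp: eventually_sequentially)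
      then show False using N_reverse[OF EK[of "r k"] Eg] \<open>N g = 0\<close> Klow[of "r k"] by linarith
    qed
    then have "AE x in M. \<exists>n. 0 < (V ^^ n) g x" by (rule irr[OF Eg gpos])
    moreover have "AE x in M. \<forall>n. 0 \<le> (V ^^ n) g x"
      using op_pos[OF pos_pow Eg gpos] by (simp add: AE_all_countable)
    ultimately have conv: "AE x in M. (\<lambda>l. 1 - min 1 (Z l g x)) \<longlonglongrightarrow> 0"
    proof eventually_elim
      case (elim x)
      then obtain n where n: "0 < (V ^^ n) g x" by blast
      obtain l0 :: nat where l0: "real l0 > 1 / (V ^^ n) g x" using reals_Archimedean2 by blast
      have "1 - min 1 (Z l g x) = 0" if l: "l \<ge> max l0 (Suc n)" for l
      proof -
        have "1 \<le> real l0 * (V ^^ n) g x" using l0 n by (simp add: field_simps)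
        also have "\<dots> \<le> real l * (\<Sum>n<l. (V ^^ n) g x)"
          using elim l by (intro mult_mono member_le_sum) auto
        finally show ?thesis by (simp add: Z_def)
      qed
      then show ?case by (intro tendsto_eventually eventually_sequentiallyI[of "max l0 (Suc n)"])
    qed
    have Zpos: "AE x in M. 0 \<le> Z l f x" if "E f" "AE x in M. 0 \<le> f x" for f l
    proof -
      have "AE x in M. \<forall>n. 0 \<le> (V ^^ n) f x"
        using op_pos[OF pos_pow that] by (simp add: AE_all_countable)
      then show ?thesis by eventually_elim (auto simp: Z_def intro!: mult_nonneg_nonneg sum_nonneg)
    qed
    have E1: "E (\<lambda>x. 1 - min 1 (Z l f x))" if "E f" for f l
      using that by (intro E_diff E_min E_const E_Z)
    have "(\<lambda>l. N (\<lambda>x. 1 - min 1 (Z l g x))) \<longlonglongrightarrow> 0"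
    proof (rule N_dominated_tendsto_0[OF E1[OF Eg] E_const[of 1] _ conv])
      show "AE x in M. \<bar>1 - min 1 (Z n g x)\<bar> \<le> \<bar>1\<bar>" for n
        using Zpos[OF Eg gpos, of n] by eventually_elim auto
    qed
    then have "\<forall>\<^sub>F l in sequentially. N (\<lambda>x. 1 - min 1 (Z l g x)) < \<rho> / 2"
      using \<rho> by (intro order_tendstoD) auto
    then obtain l where l: "N (\<lambda>x. 1 - min 1 (Z l g x)) < \<rho> / 2" by (auto simp: eventually_sequentially)
    have "(\<lambda>k. z l * N (\<lambda>x. K (F (r k)) x - g x)) \<longlonglongrightarrow> z l * 0"
      by (intro tendsto_mult tendsto_const lim)
    then have "\<forall>\<^sub>F k in sequentially. z l * N (\<lambda>x. K (F (r k)) x - g x) < \<rho> / 2"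
      using \<rho> by (intro order_tendstoD) auto
    then obtain k0 where k0: "\<And>k. k \<ge> k0 \<Longrightarrow> z l * N (\<lambda>x. K (F (r k)) x - g x) < \<rho> / 2"
      by (auto simp: eventually_sequentially)
    \<comment> \<open>k \<ge> k0 makes \<open>K (F (r k))\<close> close to g, and k \<ge> l gives r
      k \<ge> l, so \<open>Z (r k)\<close> dominates \<open>Z l\<close> there. Thus one l, chosen
      for g alone, contradicts the choice of \<open>F (r k)\<close>; the comparison uses that t
      \<mapsto> min 1 t is 1-Lipschitz.\<close>
    define k where "k = max k0 l"
    let ?f = "K (F (r k))"
    have rk: "l \<le> r k" using seq_suble[OF rg(1), of k] by (simp add: k_def)
    have "N (\<lambda>x. 1 - min 1 (Z (r k) ?f x)) \<le> N (\<lambda>x. \<bar>1 - min 1 (Z l g x)\<bar> + \<bar>Z l (\<lambda>x. ?f x - g x) x\<bar>)"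
    proof (rule N_mono)
      have "AE x in M. \<forall>n. 0 \<le> (V ^^ n) ?f x"
        using op_pos[OF pos_pow EK Kpos] by (simp add: AE_all_countable)
      then have "AE x in M. Z l ?f x \<le> Z (r k) ?f x"
      proof eventually_elim
        case (elim x)
        then have "(\<Sum>n<l. (V ^^ n) ?f x) \<le> (\<Sum>n<r k. (V ^^ n) ?f x)"
          using rk by (intro sum_mono2) auto
        then show ?case unfolding Z_def using rk elim by (intro mult_mono sum_nonneg) auto
      qed
      then show "AE x in M. \<bar>1 - min 1 (Z (r k) ?f x)\<bar> \<le> \<bar>\<bar>1 - min 1 (Z l g x)\<bar> + \<bar>Z l (\<lambda>x. ?f x - g x) x\<bar>\<bar>"
        using Z_diff[OF EK Eg, of l "r k"]
        by eventually_elim linarith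
      show "E (\<lambda>x. 1 - min 1 (Z (r k) ?f x))" by (rule E1[OF EK])
      show "E (\<lambda>x. \<bar>1 - min 1 (Z l g x)\<bar> + \<bar>Z l (\<lambda>x. ?f x - g x) x\<bar>)"
        by (intro E_add E_abs E1 E_Z E_diff EK Eg)
    qed
    also have "\<dots> \<le> N (\<lambda>x. 1 - min 1 (Z l g x)) + N (Z l (\<lambda>x. ?f x - g x))"
      using N_add[OF E_abs[OF E1[OF Eg]] E_abs[OF E_Z[OF E_diff[OF EK Eg]]], of l l "r k"] by (simp add: N_abs)
    also have "\<dots> \<le> N (\<lambda>x. 1 - min 1 (Z l g x)) + z l * N (\<lambda>x. ?f x - g x)"
      by (intro add_left_mono N_Z_le E_diff EK Eg)
    also have "\<dots> < \<rho>" using l k0[of k] by (simp add: k_def)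
    finally show False using F(4)[of "r k"] by simp
  qed
  with \<rho> show ?thesis using that by blast
qed

text \<open>The iterates of the invariant map starting at 1 never come closer to 0 than 1/2 in norm.
  Each is dominated by \<open>Z l\<close> applied to K of its predecessor, and \<open>Z l\<close>
  commutes with the powers of V up to null sets, so N (F k) \<le> z l ^ k * b (k * i). Hence the
  powers of K cannot decay faster than geometrically: their spectral radius is at least 1/c.\<close>

lemma b_lower: obtains c where "1 \<le> c" "\<And>k. 1 / 2 \<le> c ^ k * b (k * i)"
proof -
  obtain \<rho> l where \<rho>: "0 < \<rho>" "\<rho> \<le> 1/2" and inv:
    "\<And>f. E f \<Longrightarrow> AE x in M. 0 \<le> f x \<and> f x \<le> 1 \<Longrightarrow> N (\<lambda>x. 1 - f x) \<le> \<rho> \<Longrightarrow> N (\<lambda>x. 1 - min 1 (Z l (K f) x)) \<le> \<rho>"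
    using invariant_ball by blast
  define F where "F = rec_nat (\<lambda>_. 1) (\<lambda>_ f x. min 1 (Z l (K f) x))"
  have F0: "F 0 = (\<lambda>_. 1)" and FS: "F (Suc k) = (\<lambda>x. min 1 (Z l (K (F k)) x))" for k
    by (simp_all add: F_def)
  have inF: "E (F k) \<and> (AE x in M. 0 \<le> F k x \<and> F k x \<le> 1) \<and> N (\<lambda>x. 1 - F k x) \<le> \<rho>" for k
  proof (induction k)
    case 0 show ?case using \<rho> by (simp add: F0 E_const N_const)
  next
    case (Suc k)
    then have E: "E (K (F k))" and P: "AE x in M. 0 \<le> K (F k) x"
      using op_pos[OF pos_pow, of "F k" i] by (auto intro: pow_E elim: eventually_mono)
    have "AE x in M. \<forall>n. 0 \<le> (V ^^ n) (K (F k)) x"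
      using op_pos[OF pos_pow E P] by (simp add: AE_all_countable)
    then have "AE x in M. 0 \<le> Z l (K (F k)) x"
      by eventually_elim (auto simp: Z_def intro!: mult_nonneg_nonneg sum_nonneg)
    then have "AE x in M. 0 \<le> F (Suc k) x \<and> F (Suc k) x \<le> 1"
      by eventually_elim (auto simp: FS)
    then show ?case using Suc inv[of "F k"] E by (auto simp: FS intro!: E_min E_const E_Z)
  qed
  have step: "N ((V ^^ n) (F (Suc k))) \<le> z l * N ((V ^^ (n + i)) (F k))" for n k
  proof -
    have E: "E (K (F k))" using inF[of k] by (auto intro: pow_E)
    have "AE x in M. \<bar>F (Suc k) x\<bar> \<le> Z l (K (F k)) x"
      using inF[of "Suc k"] by (auto simp: FS elim: eventually_mono)
    then have "N ((V ^^ n) (F (Suc k))) \<le> N ((V ^^ n) (Z l (K (F k))))"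
      using inF[of "Suc k"] E by (intro op_N_mono[OF pos_pow] E_Z) auto
    also have "\<dots> = N (Z l ((V ^^ n) (K (F k))))"
      by (intro N_cong pow_Z E_Z pow_E[OF E] pow_E[OF E_Z] E)
    also have "\<dots> \<le> z l * N ((V ^^ n) (K (F k)))" by (intro N_Z_le pow_E E)
    finally show ?thesis by (simp add: funpow_add)
  qed
  have iter: "N ((V ^^ n) (F k)) \<le> z l ^ k * N ((V ^^ (n + k * i)) (\<lambda>_. 1))" for n k
  proof (induction k arbitrary: n)
    case (Suc k)
    have "N ((V ^^ n) (F (Suc k))) \<le> z l * N ((V ^^ (n + i)) (F k))" by (rule step)
    also have "\<dots> \<le> z l * (z l ^ k * N ((V ^^ (n + i + k * i)) (\<lambda>_. 1)))"
      by (intro mult_left_mono Suc z_nonneg)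
    finally show ?case by (simp add: ac_simps)
  qed (simp add: F0)
  define c where "c = max 1 (z l)"
  have "1 / 2 \<le> c ^ k * b (k * i)" for k
  proof -
    have "1 \<le> N (F k) + N (\<lambda>x. 1 - F k x)"
      using N_reverse[OF E_const[of 1], of "F k"] inF[of k] by (simp add: N_const)
    then have "1 / 2 \<le> N (F k)" using inF[of k] \<rho> by linarith
    also have "\<dots> \<le> z l ^ k * N ((V ^^ (k * i)) (\<lambda>_. 1))" using iter[of 0 k] by simp
    also have "\<dots> \<le> c ^ k * b (k * i)"
      unfolding c_def using z_nonneg[of l] by (intro mult_mono power_mono orbit_le_b N_nonneg) auto
    finally show ?thesis .
  qed
  then show ?thesis by (intro that[of c]) (auto simp: c_def)
qed

section \<open>Growth rate of the powers of V and its comparison with single orbits\<close>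

definition growth :: real where
  "growth = lim (\<lambda>n. ln (b n) / real n)"

lemma growth: "(\<lambda>n. ln (b n) / real n) \<longlonglongrightarrow> growth" "growth * real n \<le> ln (b n)"
proof -
  obtain c where c: "1 \<le> c" "\<And>k. 1 / 2 \<le> c ^ k * b (k * i)" using b_lower by blast
  have sub: "ln (b (m + n)) \<le> ln (b m) + ln (b n)" for m n
    using b_add[of m n] b_pos by (simp flip: ln_mult_pos)
  \<comment> \<open>\<open>b_power\<close> converts the bound at exponent n i into 1/2 \<le> c^n (b
    n)^i. If ln (b n) lay below the claimed value it would be negative, and multiplying it by i
    \<ge> 1 would only lower it, contradicting this inequality.\<close>
  have low: "- (ln c + ln 2) * real n \<le> ln (b n)" for n
  proof (cases "n = 0")
    case True then show ?thesis using sub[of 0 0] by simp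
  next
    case False
    have "1 / 2 \<le> c ^ n * b (n * i)" by (rule c)
    also have "\<dots> \<le> c ^ n * b n ^ i" using c b_power[OF i, of n] by (intro mult_left_mono) (auto simp: mult.commute)
    finally have "ln (1 / 2) \<le> ln (c ^ n * b n ^ i)" by simp
    also have "\<dots> = real n * ln c + real i * ln (b n)"
      using c b_pos[of n] by (simp add: ln_mult_pos ln_realpow)
    finally have *: "- ln 2 - real n * ln c \<le> real i * ln (b n)" by (simp add: ln_div)
    have nc: "real n * ln 2 \<ge> ln 2" "real n * ln c \<ge> 0" using False c by (auto simp: ln_ge_zero)
    show ?thesis
    proof (rule ccontr)
      assume "\<not> ?thesis"
      then have "ln (b n) < - (ln c + ln 2) * real n" by simp
      moreover have "- (ln c + ln 2) * real n \<le> 0" using c ln_ge_zero[of c] ln_ge_zero[of 2]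
        by (intro mult_nonpos_nonneg) linarith+
      ultimately have "real i * ln (b n) \<le> 1 * ln (b n)" using i by (intro mult_right_mono_neg) auto
      then show False using * \<open>ln (b n) < - (ln c + ln 2) * real n\<close> nc by (simp add: algebra_simps)
    qed
  qed
  obtain l where "(\<lambda>n. ln (b n) / real n) \<longlonglongrightarrow> l" "\<And>n. l * real n \<le> ln (b n)"
    using subadditive_limit[of "\<lambda>n. ln (b n)", OF sub low] by blast
  moreover from this have "growth = l" unfolding growth_def by (intro limI)
  ultimately show "(\<lambda>n. ln (b n) / real n) \<longlonglongrightarrow> growth" "growth * real n \<le> ln (b n)" by auto
qed

text \<open>The norms rescaled to spectral radius 1. Since \<open>growth\<close> is the infimum in
  Fekete's lemma, \<beta> never drops below 1; since it is also the limit, \<beta> grows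
  subexponentially.\<close>

definition \<beta> :: "nat \<Rightarrow> real" where "\<beta> n = b n * exp (- growth * real n)"

lemma \<beta>_ge_1: "1 \<le> \<beta> n"
proof -
  have "exp (growth * real n) \<le> b n"
    using growth(2)[of n] b_pos[of n] by (metis exp_le_cancel_iff exp_ln)
  then have "exp (growth * real n) * exp (- growth * real n) \<le> \<beta> n"
    unfolding \<beta>_def by (intro mult_right_mono) auto
  then show ?thesis by (simp flip: exp_add)
qed

lemma ln_\<beta>_tendsto: "(\<lambda>n. ln (\<beta> n) / real n) \<longlonglongrightarrow> 0"
proof -
  have "(\<lambda>n. ln (b n) / real n - growth) \<longlonglongrightarrow> growth - growth"
    by (intro tendsto_diff growth tendsto_const)
  moreover have "\<forall>\<^sub>F n in sequentially. ln (b n) / real n - growth = ln (\<beta> n) / real n"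
    using eventually_ge_at_top[of 1]
    by eventually_elim (simp add: \<beta>_def ln_mult_pos b_pos field_simps)
  ultimately show ?thesis by (simp add: Lim_transform_eventually)
qed

lemma \<beta>_rec:
  assumes q: "E q" "AE x in M. 0 < q x"
  obtains m where "0 < m" "\<And>n. \<beta> (n + i) \<le> m * (N ((V ^^ n) q) * exp (- growth * real n)) + \<beta> n / 2"
proof -
  \<comment> \<open>Rescaling at n + i instead of n divides by \<open>?e\<close>. Taking \<epsilon>
    = \<open>?e / 2\<close> therefore leaves exactly the factor 1/2 before \<beta> n, and m becomes
    \<open>m / ?e\<close>.\<close>
  let ?e = "exp (growth * real i)"
  obtain m where m: "0 < m" "\<And>A. pos_op A \<Longrightarrow> opn (A \<circ> K) \<le> m * N (A q) + (?e / 2) * opn A"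
    using compact_opn_le[OF pos_pow cpt q, of "?e / 2"] by auto
  have "\<beta> (n + i) \<le> (m / ?e) * (N ((V ^^ n) q) * exp (- growth * real n)) + \<beta> n / 2" for n
  proof -
    let ?w = "exp (- growth * real n)"
    have w: "exp (- growth * real (n + i)) = ?w / ?e"
      by (simp add: exp_diff[symmetric] algebra_simps)
    have "b (n + i) \<le> m * N ((V ^^ n) q) + (?e / 2) * b n"
      using m(2)[OF pos_pow, of n] by (simp only: funpow_add)
    then have "b (n + i) * (?w / ?e) \<le> (m * N ((V ^^ n) q) + (?e / 2) * b n) * (?w / ?e)"
      by (rule mult_right_mono) auto
    also have "\<dots> = (m / ?e) * (N ((V ^^ n) q) * ?w) + b n * ?w / 2"
      by (simp add: field_simps)
    finally show ?thesis unfolding \<beta>_def w by simp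
  qed
  then show ?thesis using m by (intro that[of "m / ?e"]) auto
qed

text \<open>The rescaled orbit norm \<alpha> satisfies c \<beta>^(-s) \<le> \<alpha> \<le> \<beta>
  for some c > 0 and some s. As \<beta> is subexponential, so is \<alpha> in both directions, and
  undoing the rescaling adds \<open>growth\<close>.\<close>

theorem orbit_growth: "(\<lambda>n. ln (N ((V ^^ n) (\<lambda>_. 1))) / real n) \<longlonglongrightarrow> growth"
proof -
  define \<alpha> where "\<alpha> n = N ((V ^^ n) (\<lambda>_. 1)) * exp (- growth * real n)" for n
  have \<alpha>: "0 < \<alpha> n" "\<alpha> n \<le> \<beta> n" for n
    using orbit_pos[of n] orbit_le_b[of n] by (auto simp: \<alpha>_def \<beta>_def)
  obtain m where m: "0 < m" "\<And>n. \<beta> (n + i) \<le> m * \<alpha> n + \<beta> n / 2"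
    using \<beta>_rec[OF E_const[of 1]] unfolding \<alpha>_def by auto
  have "\<alpha> (n + i) \<le> \<beta> i * \<alpha> n" for n
  proof -
    have "N ((V ^^ (n + i)) (\<lambda>_. 1)) \<le> b i * N ((V ^^ n) (\<lambda>_. 1))"
      using b_le[OF pow_E[OF E_const[of 1]], of i n] by (simp add: funpow_add add.commute)
    then have "N ((V ^^ (n + i)) (\<lambda>_. 1)) * exp (- growth * real (n + i)) \<le> b i * N ((V ^^ n) (\<lambda>_. 1)) * exp (- growth * real (n + i))"
      by (rule mult_right_mono) auto
    also have "\<dots> = \<beta> i * \<alpha> n" by (simp add: \<alpha>_def \<beta>_def algebra_simps flip: exp_add)
    finally show ?thesis by (simp add: \<alpha>_def)
  qed
  from polynomial_lower_bound[where \<beta> = \<beta> and \<alpha> = \<alpha> and i = i and m = m and D = "\<beta> i", OF \<beta>_ge_1 less_imp_le[OF \<alpha>(1)] m(2) this \<beta>_ge_1 m(1)]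
  obtain c s where c: "0 < c" "\<And>n. c \<le> \<alpha> n * \<beta> n ^ s" by blast
  have "(\<lambda>n. ln (\<alpha> n) / real n) \<longlonglongrightarrow> 0"
  proof (rule tendsto_sandwich[OF _ _ _ ln_\<beta>_tendsto])
    have "(\<lambda>n. ln c / real n - real s * (ln (\<beta> n) / real n)) \<longlonglongrightarrow> 0 - real s * 0"
      by (intro tendsto_diff tendsto_mult tendsto_const ln_\<beta>_tendsto lim_const_over_n)
    then show "(\<lambda>n. ln c / real n - real s * (ln (\<beta> n) / real n)) \<longlonglongrightarrow> 0" by simp
    show "\<forall>\<^sub>F n in sequentially. ln c / real n - real s * (ln (\<beta> n) / real n) \<le> ln (\<alpha> n) / real n"
    proof (rule always_eventually, rule allI)
      fix n
      have "\<beta> n > 0" using \<beta>_ge_1[of n] by simp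
      have "ln c \<le> ln (\<alpha> n * \<beta> n ^ s)" by (intro ln_mono c)
      also have "\<dots> = ln (\<alpha> n) + real s * ln (\<beta> n)"
        using \<alpha>[of n] \<open>\<beta> n > 0\<close> by (simp add: ln_mult_pos ln_realpow)
      finally have "(ln c - real s * ln (\<beta> n)) / real n \<le> ln (\<alpha> n) / real n"
        by (intro divide_right_mono) auto
      then show "ln c / real n - real s * (ln (\<beta> n) / real n) \<le> ln (\<alpha> n) / real n"
        by (simp add: diff_divide_distrib)
    qed
    show "\<forall>\<^sub>F n in sequentially. ln (\<alpha> n) / real n \<le> ln (\<beta> n) / real n"
      using \<alpha> by (intro always_eventually allI divide_right_mono ln_mono) auto
  qed
  then have "(\<lambda>n. ln (\<alpha> n) / real n + growth) \<longlonglongrightarrow> 0 + growth"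
    by (intro tendsto_add tendsto_const)
  moreover have "\<forall>\<^sub>F n in sequentially. ln (\<alpha> n) / real n + growth = ln (N ((V ^^ n) (\<lambda>_. 1))) / real n"
    using eventually_ge_at_top[of 1]
    by eventually_elim (simp add: \<alpha>_def ln_mult_pos orbit_pos field_simps)
  ultimately show ?thesis by (simp add: Lim_transform_eventually)
qed

text \<open>If \<open>growth\<close> were nonnegative, the rescaling factor would be at most 1, so
  the error in \<open>\<beta>_rec\<close> would tend to 0. Repeated halving would then push \<beta>
  below 1.\<close>

lemma growth_neg_if_orbit_null:
  assumes q: "E q" "AE x in M. 0 < q x" and null: "(\<lambda>n. N ((V ^^ n) q)) \<longlonglongrightarrow> 0"
  shows "growth < 0"
proof (rule ccontr)
  assume nn: "\<not> growth < 0"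
  obtain m where m: "0 < m" "\<And>n. \<beta> (n + i) \<le> m * (N ((V ^^ n) q) * exp (- growth * real n)) + \<beta> n / 2"
    using \<beta>_rec[OF q] by blast
  have "(\<lambda>n. m * N ((V ^^ n) q)) \<longlonglongrightarrow> m * 0" by (intro tendsto_mult tendsto_const null)
  then have "\<forall>\<^sub>F n in sequentially. m * N ((V ^^ n) q) < 1/4" by (intro order_tendstoD) auto
  then obtain n0 where n0: "\<And>n. n \<ge> n0 \<Longrightarrow> m * N ((V ^^ n) q) < 1/4" by (auto simp: eventually_sequentially)
  have step: "\<beta> (n + i) \<le> 1/4 + \<beta> n / 2" if "n \<ge> n0" for n
  proof -
    have "N ((V ^^ n) q) * exp (- growth * real n) \<le> N ((V ^^ n) q) * 1"
      using nn N_nonneg by (intro mult_left_mono) auto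
    then have "m * (N ((V ^^ n) q) * exp (- growth * real n)) \<le> m * N ((V ^^ n) q)" using m by simp
    then show ?thesis using m(2)[of n] n0[OF that] by linarith
  qed
  \<comment> \<open>1/2 is the fixed point of t \<mapsto> 1/4 + t/2, so only the distance above it
    has to be halved.\<close>
  have "\<beta> (n0 + k * i) \<le> 1/2 + \<beta> n0 / 2 ^ k" for k
  proof (induction k)
    case (Suc k)
    have "\<beta> (n0 + Suc k * i) \<le> 1/4 + \<beta> (n0 + k * i) / 2" using step[of "n0 + k * i"] by (simp add: ac_simps)
    then show ?case using Suc by simp
  qed simp
  note decay = this
  obtain k :: nat where "2 * \<beta> n0 < 2 ^ k" using real_arch_pow[of 2 "2 * \<beta> n0"] by auto
  then have "\<beta> n0 / 2 ^ k < 1/2" by (simp add: field_simps)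
  then show False using \<beta>_ge_1[of "n0 + k * i"] decay[of k] by linarith
qed

text \<open>The rate \<open>growth / 2\<close> lies strictly between \<open>growth\<close> and 0, so
  e^{growth/2} is an eventual geometric ratio below 1.\<close>

lemma summable_b: assumes "growth < 0" shows "summable b"
proof (rule summable_comparison_test_ev)
  have "\<forall>\<^sub>F n in sequentially. ln (b n) / real n < growth / 2"
    using assms by (intro order_tendstoD(2)[OF growth(1)]) auto
  then show "\<forall>\<^sub>F n in sequentially. norm (b n) \<le> exp (growth / 2) ^ n"
    using eventually_ge_at_top[of 1]
  proof eventually_elim
    case (elim n)
    then have "ln (b n) \<le> real n * (growth / 2)" by (simp add: field_simps)
    then have "b n \<le> exp (real n * (growth / 2))" using b_pos[of n] by (metis exp_le_cancel_iff exp_ln)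
    then show ?case using b_nonneg[of n] by (simp only: exp_of_nat_mult real_norm_def abs_of_nonneg)
  qed
  show "summable (\<lambda>n. exp (growth / 2) ^ n)" using assms by (intro summable_geometric) auto
qed

end

subsection \<open>The affine fixed point equation\<close>

locale affine_op = irreducible_op +
  fixes G :: "'a \<Rightarrow> real" and T
  assumes EG: "E G" and G_pos: "AE x in M. 0 \<le> G x" and T_def: "T h x = V h x + G x"
begin

definition S :: "nat \<Rightarrow> 'a \<Rightarrow> real" where "S n x = (\<Sum>j<n. (V ^^ j) G x)"

lemma E_S: "E (S n)"
  unfolding S_def by (intro E_sum pow_E EG)

lemma E_T: "E h \<Longrightarrow> E (T h)"
  using E_add[OF op_E[OF pos] EG, of h] by (simp add: T_def[abs_def])

lemma pow_G_pos: "AE x in M. \<forall>n. 0 \<le> (V ^^ n) G x"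
  using op_pos[OF pos_pow EG G_pos] by (simp add: AE_all_countable)

lemma S_pos: "AE x in M. 0 \<le> S n x"
  using pow_G_pos by eventually_elim (auto simp: S_def intro: sum_nonneg)

lemma E_T_pow: "E h \<Longrightarrow> E ((T ^^ n) h)"
  by (induction n) (auto simp: E_T)

lemma V_S: "AE x in M. V (S n) x + G x = S (Suc n) x"
proof -
  have "AE x in M. V (S n) x = (\<Sum>j<n. V ((V ^^ j) G) x)"
    unfolding S_def by (intro op_sum[OF pos] pow_E EG)
  then show ?thesis
    by eventually_elim (simp add: S_def sum.lessThan_Suc_shift del: sum.lessThan_Suc)
qed

lemma T_pow: assumes h: "E h" shows "AE x in M. (T ^^ n) h x = (V ^^ n) h x + S n x"
proof (induction n)
  case (Suc n)
  have "AE x in M. V ((T ^^ n) h) x = V (\<lambda>x. (V ^^ n) h x + S n x) x"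
    by (intro op_cong[OF pos] E_T_pow E_add pow_E E_S h Suc)
  moreover have "AE x in M. V (\<lambda>x. (V ^^ n) h x + S n x) x = V ((V ^^ n) h) x + V (S n) x"
    by (intro op_add[OF pos] pow_E E_S h)
  ultimately show ?case using V_S[of n] by eventually_elim (simp add: T_def[of "(T ^^ n) h"])
qed (simp add: S_def)

text \<open>The equation is substituted inside V^n, so each step splits off the next term V^n G of
  the series.\<close>

lemma fixed_iterate:
  assumes h: "E h" "AE x in M. h x = T h x" shows "AE x in M. h x = (V ^^ n) h x + S n x"
proof (induction n)
  case (Suc n)
  have "AE x in M. (V ^^ n) h x = (V ^^ n) (\<lambda>x. V h x + G x) x"
    using h unfolding T_def by (intro op_cong[OF pos_pow] E_add op_E[OF pos] EG)
  moreover have "AE x in M. (V ^^ n) (\<lambda>x. V h x + G x) x = (V ^^ n) (V h) x + (V ^^ n) G x"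
    by (intro op_add[OF pos_pow] op_E[OF pos] h EG)
  ultimately show ?case using Suc
    by eventually_elim (simp add: S_def funpow_swap1)
qed (simp add: S_def)

text \<open>Bounded norms of the partial sums suffice, because the terms are nonnegative: the sums
  then converge in norm, and continuity of V passes the recursion to the limit. Moreover V^n q = q -
  S n is the tail of the series, hence tends to 0. The bound is supplied by a dominating solution in
  one direction and by summable operator norms in the other.\<close>

lemma series_fixed_point:
  assumes bd: "\<And>n. N (S n) \<le> C"
  obtains q where "E q" "AE x in M. 0 \<le> q x" "AE x in M. (\<lambda>n. S n x) \<longlonglongrightarrow> q x"
    "\<And>n. AE x in M. S n x \<le> q x" "AE x in M. q x = T q x" "(\<lambda>n. N ((V ^^ n) q)) \<longlonglongrightarrow> 0"
proof -
  have inc: "AE x in M. S n x \<le> S (Suc n) x" for n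
    using pow_G_pos by eventually_elim (simp add: S_def)
  obtain q where q: "E q" "AE x in M. (\<lambda>n. S n x) \<longlonglongrightarrow> q x"
    "\<And>n. AE x in M. S n x \<le> q x" "(\<lambda>n. N (\<lambda>x. q x - S n x)) \<longlonglongrightarrow> 0"
    using N_monotone_limit[where s = S and C = C, OF E_S S_pos inc bd] by blast
  have "AE x in M. 0 \<le> q x" using q(3)[of 0] by (simp add: S_def)
  have fix_q: "AE x in M. q x = T q x"
  proof -
    have "N (\<lambda>x. T q x - q x) \<le> b 1 * N (\<lambda>x. q x - S n x) + N (\<lambda>x. q x - S (Suc n) x)" for n
    proof -
      have "N (\<lambda>x. T q x - q x) \<le> N (\<lambda>x. T q x - S (Suc n) x) + N (\<lambda>x. S (Suc n) x - q x)"
        by (intro N_triangle E_T q E_S)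
      also have "N (\<lambda>x. T q x - S (Suc n) x) = N (\<lambda>x. V q x - V (S n) x)"
        using V_S[of n] by (intro N_cong E_diff E_T q E_S op_E[OF pos]) (auto simp: T_def elim: eventually_mono)
      also have "\<dots> = N (V (\<lambda>x. q x - S n x))" by (intro op_N_diff[OF pos] q E_S)
      also have "N (\<lambda>x. S (Suc n) x - q x) = N (\<lambda>x. q x - S (Suc n) x)" by (rule N_minus)
      also have "N (V (\<lambda>x. q x - S n x)) + N (\<lambda>x. q x - S (Suc n) x) \<le> b 1 * N (\<lambda>x. q x - S n x) + N (\<lambda>x. q x - S (Suc n) x)"
        using b_le[OF E_diff[OF q(1) E_S], of 1 n] by simp
      finally show ?thesis .
    qed
    moreover have "(\<lambda>n. b 1 * N (\<lambda>x. q x - S n x) + N (\<lambda>x. q x - S (Suc n) x)) \<longlonglongrightarrow> b 1 * 0 + 0"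
      by (intro tendsto_add tendsto_mult tendsto_const q LIMSEQ_Suc[OF q(4)])
    ultimately have "N (\<lambda>x. T q x - q x) \<le> b 1 * 0 + 0" by (intro LIMSEQ_le_const) auto
    then have "N (\<lambda>x. T q x - q x) = 0" using N_nonneg[of "\<lambda>x. T q x - q x"] by simp
    then show ?thesis using N_eq_0_iff[OF E_diff[OF E_T[OF q(1)] q(1)]] by (auto elim: eventually_mono)
  qed
  have "N ((V ^^ n) q) = N (\<lambda>x. q x - S n x)" for n
    using fixed_iterate[OF q(1) fix_q, of n]
    by (intro N_cong pow_E E_diff q E_S) (auto elim: eventually_mono)
  with q fix_q \<open>AE x in M. 0 \<le> q x\<close> show ?thesis by (intro that[of q]) auto
qed

text \<open>Since V^n h \<ge> 0, any solution h dominates all partial sums, so the minimal solution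
  q exists. It is at least every V^n G and therefore a.e. positive, which makes it an admissible
  comparison function with null orbit.\<close>

lemma growth_neg_if_fixed_point:
  assumes h: "E h" "AE x in M. 0 \<le> h x" "AE x in M. h x = T h x" and G: "\<not> (AE x in M. G x = 0)"
  shows "growth < 0"
proof -
  have bd: "N (S n) \<le> N h" for n
  proof (rule N_mono[OF E_S h(1)])
    have "AE x in M. 0 \<le> (V ^^ n) h x" by (intro op_pos[OF pos_pow] h)
    then show "AE x in M. \<bar>S n x\<bar> \<le> \<bar>h x\<bar>"
      using fixed_iterate[OF h(1,3), of n] S_pos[of n] h(2) by eventually_elim simp
  qed
  then obtain q where q: "E q" "\<And>n. AE x in M. S n x \<le> q x" "(\<lambda>n. N ((V ^^ n) q)) \<longlonglongrightarrow> 0"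
    using series_fixed_point[OF bd] by blast
  have "AE x in M. \<forall>n. S n x \<le> q x" using q(2) by (simp add: AE_all_countable)
  then have "AE x in M. 0 < q x"
    using irr[OF EG G_pos G] pow_G_pos
  proof eventually_elim
    case (elim x)
    then obtain n where n: "0 < (V ^^ n) G x" by blast
    also have "(V ^^ n) G x \<le> S (Suc n) x" unfolding S_def using elim by (intro member_le_sum) auto
    also have "\<dots> \<le> q x" using elim by blast
    finally show ?case .
  qed
  then show ?thesis using q by (intro growth_neg_if_orbit_null)
qed

text \<open>Everything rests on T^n h - q = V^n (h - q), whose norm tends to 0 because the operator
  norms are summable. Uniqueness is the case where T^n h does not depend on n; it holds among all
  p-integrable functions, whatever their sign.\<close>

lemma fixed_point_if_growth_neg:
  assumes neg: "growth < 0"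
  obtains q where "E q" "AE x in M. 0 \<le> q x" "AE x in M. (\<lambda>n. S n x) \<longlonglongrightarrow> q x"
    "AE x in M. q x = T q x" "\<And>h. E h \<Longrightarrow> (\<lambda>n. N (\<lambda>x. (T ^^ n) h x - q x)) \<longlonglongrightarrow> 0"
    "\<And>h. E h \<Longrightarrow> AE x in M. h x = T h x \<Longrightarrow> AE x in M. h x = q x"
proof -
  have sb: "summable b" by (rule summable_b[OF neg])
  have null: "(\<lambda>n. N ((V ^^ n) h)) \<longlonglongrightarrow> 0" if "E h" for h
  proof (rule tendsto_sandwich[OF _ _ tendsto_const])
    show "(\<lambda>n. b n * N h) \<longlonglongrightarrow> 0" using tendsto_mult_right[OF summable_LIMSEQ_zero[OF sb], of "N h"] by simp
  qed (use that b_le N_nonneg in auto)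
  have bd: "N (S n) \<le> suminf b * N G" for n
  proof -
    have "N (S n) \<le> (\<Sum>j<n. N ((V ^^ j) G))" unfolding S_def by (intro N_sum pow_E EG)
    also have "\<dots> \<le> (\<Sum>j<n. b j * N G)" by (intro sum_mono b_le EG)
    also have "\<dots> = (\<Sum>j<n. b j) * N G" by (simp add: sum_distrib_right)
    also have "\<dots> \<le> suminf b * N G"
      by (intro mult_right_mono sum_le_suminf sb b_nonneg N_nonneg) auto
    finally show ?thesis .
  qed
  then obtain q where q: "E q" "AE x in M. 0 \<le> q x" "AE x in M. (\<lambda>n. S n x) \<longlonglongrightarrow> q x" "AE x in M. q x = T q x"
    using series_fixed_point[OF bd] by blast
  have conv: "(\<lambda>n. N (\<lambda>x. (T ^^ n) h x - q x)) \<longlonglongrightarrow> 0" if h: "E h" for h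
  proof -
    have "N (\<lambda>x. (T ^^ n) h x - q x) = N ((V ^^ n) (\<lambda>x. h x - q x))" for n
    proof -
      have "AE x in M. (T ^^ n) h x - q x = (V ^^ n) h x - (V ^^ n) q x"
        using T_pow[OF h, of n] fixed_iterate[OF q(1,4), of n] by eventually_elim simp
      then have "N (\<lambda>x. (T ^^ n) h x - q x) = N (\<lambda>x. (V ^^ n) h x - (V ^^ n) q x)"
        by (intro N_cong E_diff E_T_pow pow_E h q)
      then show ?thesis by (simp add: op_N_diff[OF pos_pow h q(1)])
    qed
    then show ?thesis using null[OF E_diff[OF h q(1)]] by simp
  qed
  have uniq: "AE x in M. h x = q x" if h: "E h" "AE x in M. h x = T h x" for h
  proof -
    have "N (\<lambda>x. (T ^^ n) h x - q x) = N (\<lambda>x. h x - q x)" for n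
    proof -
      have "AE x in M. (T ^^ n) h x - q x = h x - q x"
        using T_pow[OF h(1), of n] fixed_iterate[OF h, of n] by eventually_elim simp
      then show ?thesis by (intro N_cong E_diff E_T_pow h q)
    qed
    then have "N (\<lambda>x. h x - q x) = 0" using conv[OF h(1)] by (simp add: LIMSEQ_const_iff)
    then show ?thesis using N_eq_0_iff[OF E_diff[OF h(1) q(1)]] by (auto elim: eventually_mono)
  qed
  show ?thesis using q conv uniq by (intro that[of q]) auto
qed

text \<open>T f - T h = V (f - h), so T is Lipschitz with constant \<open>b 1\<close>; the shifted
  iterates then converge both to f and to T f.\<close>

lemma limit_is_fixed_point:
  assumes h: "E h" and f: "E f" and lim: "(\<lambda>n. N (\<lambda>x. (T ^^ n) h x - f x)) \<longlonglongrightarrow> 0"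
  shows "AE x in M. f x = T f x"
proof -
  have "N (\<lambda>x. f x - T f x) \<le> N (\<lambda>x. (T ^^ Suc n) h x - f x) + b 1 * N (\<lambda>x. (T ^^ n) h x - f x)" for n
  proof -
    have "N (\<lambda>x. f x - T f x) \<le> N (\<lambda>x. f x - (T ^^ Suc n) h x) + N (\<lambda>x. (T ^^ Suc n) h x - T f x)"
      by (intro N_triangle f E_T E_T_pow h)
    also have "(\<lambda>x. (T ^^ Suc n) h x - T f x) = (\<lambda>x. V ((T ^^ n) h) x - V f x)"
      by (simp add: T_def)
    also have "N (\<lambda>x. V ((T ^^ n) h) x - V f x) = N (V (\<lambda>x. (T ^^ n) h x - f x))"
      by (intro op_N_diff[OF pos] E_T_pow h f)
    also have "N (\<lambda>x. f x - (T ^^ Suc n) h x) = N (\<lambda>x. (T ^^ Suc n) h x - f x)" by (rule N_minus)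
    finally show ?thesis using b_le[OF E_diff[OF E_T_pow[OF h] f], of 1 n] by simp
  qed
  moreover have "(\<lambda>n. N (\<lambda>x. (T ^^ Suc n) h x - f x) + b 1 * N (\<lambda>x. (T ^^ n) h x - f x)) \<longlonglongrightarrow> 0 + b 1 * 0"
    by (intro tendsto_add tendsto_mult tendsto_const lim LIMSEQ_Suc[OF lim])
  ultimately have "N (\<lambda>x. f x - T f x) \<le> 0 + b 1 * 0" by (intro LIMSEQ_le_const) auto
  then have "N (\<lambda>x. f x - T f x) = 0" using N_nonneg[of "\<lambda>x. f x - T f x"] by simp
  then show ?thesis using N_eq_0_iff[OF E_diff[OF f E_T[OF f]]] by (auto elim: eventually_mono)
qed

end

subsection \<open>The valuation operator\<close>

text \<open>Every path handed to F by \<open>pathE\<close> starts at x. This allows the first factor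
  of a product along the path to be rewritten with its actual starting point.\<close>

lemma pathE_cong:
  assumes "\<And>X E. X 0 = x \<Longrightarrow> F X E = F' X E"
  shows "pathE K N n x F = pathE K N n x F'"
  using assms by (cases n) auto

locale valuation = Lp_space \<pi> p for \<pi> :: "'x::polish_space measure" and p +
  fixes Pk :: "'x \<Rightarrow> 'x measure" and \<nu> :: "'w::polish_space measure"
    and \<phi> :: "'x \<Rightarrow> 'x \<Rightarrow> 'w \<Rightarrow> real"
  assumes kernel: "Pk \<in> measurable borel (prob_algebra borel)"
    and stationary: "B \<in> sets borel \<Longrightarrow> emeasure \<pi> B = (\<integral>\<^sup>+ x. emeasure (Pk x) B \<partial>\<pi>)"
    and nu_prob: "prob_space \<nu>" and nu_sets: "sets \<nu> = sets borel"
    and phi_meas: "(\<lambda>(x, y, e). \<phi> x y e) \<in> borel_measurable borel"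
    and phi_pos: "0 < \<phi> x y e"
    and wd: "V_well_defined p \<pi> Pk \<nu> \<phi>"
    and bdd: "bounded_on_Lp p \<pi> (Vop Pk \<nu> \<phi>)"
begin

abbreviation V where "V \<equiv> Vop Pk \<nu> \<phi>"

definition Phi :: "'x \<Rightarrow> 'x \<Rightarrow> ennreal" where
  "Phi x y = (\<integral>\<^sup>+ e. ennreal (\<phi> x y e) \<partial>\<nu>)"

text \<open>The extended-real counterpart of V, defined at every point without any integrability
  condition. Its iterates are the path expectations, and it agrees with V a.e. on nonnegative
  p-integrable functions.\<close>

definition U :: "('x \<Rightarrow> ennreal) \<Rightarrow> 'x \<Rightarrow> ennreal" where
  "U F x = (\<integral>\<^sup>+ y. Phi x y * F y \<partial>Pk x)"

lemma sets_Pk [measurable_cong]: "sets (Pk x) = sets borel"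
  and prob_Pk: "prob_space (Pk x)"
  using measurable_space[OF kernel, of x] by (auto simp: space_prob_algebra)

lemma kernel_subprob [measurable]: "Pk \<in> measurable borel (subprob_algebra borel)"
  by (rule measurable_prob_algebraD[OF kernel])

lemma meas_Pk: "f \<in> borel_measurable borel \<Longrightarrow> f \<in> borel_measurable (Pk x)"
  using sets_Pk measurable_cong_sets by blast

lemma integrand_measurable:
  fixes f :: "'x \<Rightarrow> 'x \<Rightarrow> 'w \<Rightarrow> real"
  assumes "(\<lambda>(x, y, e). f x y e) \<in> borel_measurable borel"
  shows "(\<lambda>(xy, e). f (fst xy) (snd xy) e) \<in> borel_measurable ((borel \<Otimes>\<^sub>M borel) \<Otimes>\<^sub>M \<nu>)"
proof -
  have m1: "(\<lambda>(x, y, e). f x y e) \<in> borel_measurable (borel \<Otimes>\<^sub>M (borel \<Otimes>\<^sub>M borel))"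
    using assms by (simp add: borel_prod)
  have m2: "(\<lambda>(xy, e). (fst xy, snd xy, e)) \<in> measurable ((borel \<Otimes>\<^sub>M borel) \<Otimes>\<^sub>M borel) (borel \<Otimes>\<^sub>M (borel \<Otimes>\<^sub>M borel))"
    by measurable
  have "(\<lambda>(xy, e). f (fst xy) (snd xy) e) \<in> borel_measurable ((borel \<Otimes>\<^sub>M borel) \<Otimes>\<^sub>M borel)"
    using measurable_compose[OF m2 m1] by (simp add: case_prod_beta')
  then show ?thesis
    using nu_sets by (simp cong: measurable_cong_sets sets_pair_measure_cong)
qed

lemma inner_integral_measurable:
  fixes f :: "'x \<Rightarrow> 'x \<Rightarrow> 'w \<Rightarrow> real"
  assumes "(\<lambda>(x, y, e). f x y e) \<in> borel_measurable borel"
  shows "(\<lambda>(x, y). \<integral>\<^sup>+ e. ennreal (f x y e) \<partial>\<nu>) \<in> borel_measurable (borel \<Otimes>\<^sub>M borel)"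
proof -
  interpret nu: prob_space \<nu> by (rule nu_prob)
  have "(\<lambda>xy. \<integral>\<^sup>+ e. ennreal (f (fst xy) (snd xy) e) \<partial>\<nu>) \<in> borel_measurable (borel \<Otimes>\<^sub>M borel)"
    using integrand_measurable[OF assms]
    by (intro nu.borel_measurable_nn_integral) (simp add: case_prod_beta')
  then show ?thesis by (simp add: case_prod_beta')
qed

lemma section_measurable:
  fixes f :: "'x \<Rightarrow> 'x \<Rightarrow> 'w \<Rightarrow> real"
  assumes "(\<lambda>(x, y, e). f x y e) \<in> borel_measurable borel"
  shows "(\<lambda>e. f x y e) \<in> borel_measurable \<nu>"
  using measurable_compose[OF measurable_Pair1' integrand_measurable[OF assms], of "(x, y)"]
  by (simp add: space_pair_measure)

lemma Phi_measurable: "(\<lambda>(x, y). Phi x y) \<in> borel_measurable (borel \<Otimes>\<^sub>M borel)"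
  unfolding Phi_def by (rule inner_integral_measurable[OF phi_meas])

lemma Phi_measurable_section [measurable]: "Phi x \<in> borel_measurable borel"
  using measurable_compose[OF measurable_Pair1' Phi_measurable, of x] by simp

lemma Phi_pos: "0 < Phi x y"
proof -
  interpret nu: prob_space \<nu> by (rule nu_prob)
  have "Phi x y \<noteq> 0"
  proof
    assume "Phi x y = 0"
    then have "AE e in \<nu>. ennreal (\<phi> x y e) = 0"
      using section_measurable[OF phi_meas, of x y] by (simp add: Phi_def nn_integral_0_iff_AE)
    then have "AE e in \<nu>. False"
      by eventually_elim (use phi_pos[of x y] in \<open>simp add: ennreal_eq_0_iff not_le[symmetric]\<close>)
    then show False by simp
  qed
  then show ?thesis by (simp add: zero_less_iff_neq_zero)
qed

lemma U_measurable: "F \<in> borel_measurable borel \<Longrightarrow> U F \<in> borel_measurable borel"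
proof -
  assume [measurable]: "F \<in> borel_measurable borel"
  have "(\<lambda>(x, y). Phi x y * F y) \<in> borel_measurable (borel \<Otimes>\<^sub>M borel)"
    using Phi_measurable by (auto simp: case_prod_beta')
  then show ?thesis unfolding U_def[abs_def]
    by (rule nn_integral_measurable_subprob_algebra2) measurable
qed

lemma U_pow_measurable: "F \<in> borel_measurable borel \<Longrightarrow> (U ^^ n) F \<in> borel_measurable borel"
  by (induction n) (auto intro: U_measurable)

lemma U_eq_0D:
  assumes [measurable]: "F \<in> borel_measurable borel" and "U F x = 0"
  shows "AE y in Pk x. F y = 0"
proof -
  have m: "(\<lambda>y. Phi x y * F y) \<in> borel_measurable (Pk x)" by (intro meas_Pk) measurable
  have "AE y in Pk x. Phi x y * F y = 0"
    using assms(2) m by (simp add: U_def nn_integral_0_iff_AE)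
  then show ?thesis using Phi_pos[of x] by (auto elim!: eventually_mono simp: less_le)
qed

lemma U_pow_pos: "0 < (U ^^ n) (\<lambda>_. 1) x"
proof (induction n arbitrary: x)
  case (Suc n)
  have "U ((U ^^ n) (\<lambda>_. 1)) x \<noteq> 0"
  proof
    interpret P: prob_space "Pk x" by (rule prob_Pk)
    assume "U ((U ^^ n) (\<lambda>_. 1)) x = 0"
    then have "AE y in Pk x. (U ^^ n) (\<lambda>_. 1) y = 0" by (intro U_eq_0D U_pow_measurable) auto
    then have "AE y in Pk x. False" using Suc by (auto elim!: eventually_mono simp: less_le)
    then show False by simp
  qed
  then show ?case by (simp add: zero_less_iff_neq_zero)
qed simp

lemma sets_kpow: "sets (kpow Pk n x) = sets borel"
proof (induction n)
  case (Suc n)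
  then have "space (kpow Pk n x) \<noteq> {}" using sets_eq_imp_space_eq[OF Suc] by simp
  then show ?case by (simp add: sets_bind[OF sets_Pk])
qed simp

text \<open>The weight \<open>Phi\<close> is strictly positive, so U^n F can vanish at x only if F
  vanishes almost surely after n steps from x. In contrapositive form this transfers A2 from the
  kernel to \<open>U\<close>.\<close>

lemma U_pow_eq_0D:
  assumes "F \<in> borel_measurable borel" "(U ^^ n) F x = 0"
  shows "AE y in kpow Pk n x. F y = 0"
  using assms
proof (induction n arbitrary: F)
  case 0
  then have [measurable]: "F \<in> borel_measurable borel" by simp
  have "Measurable.pred borel (\<lambda>y. F y = 0)" by measurable
  then show ?case using 0 by (subst kpow.simps(1), subst AE_return) auto
next
  case (Suc n)
  note [measurable] = Suc.prems(1)
  \<comment> \<open>The innermost U is split off, matching \<open>kpow\<close>, which appends the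
    new transition at the end.\<close>
  have "AE y in kpow Pk n x. U F y = 0"
    using Suc.prems by (intro Suc.IH U_measurable) (auto simp: funpow_swap1)
  then have "AE y in kpow Pk n x. AE z in Pk y. F z = 0"
    by eventually_elim (intro U_eq_0D Suc.prems)
  moreover have "Pk \<in> measurable (kpow Pk n x) (subprob_algebra borel)"
    using kernel_subprob sets_kpow measurable_cong_sets by blast
  moreover have "Measurable.pred borel (\<lambda>y. F y = 0)" by measurable
  ultimately show ?case by (subst kpow.simps(2), subst AE_bind) auto
qed

text \<open>By stationarity a \<pi>-null set has mean Pk-mass 0, hence is Pk x-null for almost every
  x. This allows properties known only \<pi>-a.e. to be used under the kernel.\<close>

lemma AE_stationary:
  assumes "AE x in \<pi>. P x" shows "AE x in \<pi>. AE y in Pk x. P y"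
proof -
  obtain B where B: "{x \<in> space \<pi>. \<not> P x} \<subseteq> B" "emeasure \<pi> B = 0" "B \<in> sets \<pi>"
    using assms by (rule AE_E)
  have sp: "space \<pi> = UNIV" "space (Pk x) = UNIV" for x
    using sets_eq_imp_space_eq[OF sets_M] sets_eq_imp_space_eq[OF sets_Pk] by auto
  have Bb [measurable]: "B \<in> sets borel" using B sets_M by simp
  have "(\<lambda>x. emeasure (Pk x) B) \<in> borel_measurable borel" by measurable
  then have m: "(\<lambda>x. emeasure (Pk x) B) \<in> borel_measurable \<pi>"
    using sets_M measurable_cong_sets by blast
  have "(\<integral>\<^sup>+ x. emeasure (Pk x) B \<partial>\<pi>) = 0" using stationary[OF Bb] B by simp
  then have "AE x in \<pi>. emeasure (Pk x) B = 0" using m by (simp add: nn_integral_0_iff_AE)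
  then show ?thesis
  proof eventually_elim
    case (elim x)
    show ?case
      by (rule AE_I[of _ _ B]) (use elim B Bb sp sets_Pk in auto)
  qed
qed

lemma Phi_finite: "AE x in \<pi>. AE y in Pk x. Phi x y < \<infinity>"
proof -
  have "AE x in \<pi>. (\<integral>\<^sup>+ y. Phi x y \<partial>Pk x) < \<infinity>"
    using wd E_const[of 1] unfolding V_well_defined_def Phi_def by fastforce
  then show ?thesis
  proof eventually_elim
    case (elim x)
    then have "AE y in Pk x. Phi x y \<noteq> \<infinity>"
      by (intro nn_integral_PInf_AE meas_Pk) auto
    then show ?case by (auto elim: eventually_mono simp: less_top)
  qed
qed

lemma V_integrable:
  assumes "E f" shows "AE x in \<pi>. integrable (Pk x) (\<lambda>y. f y * phibar \<nu> \<phi> x y)"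
proof -
  have [measurable]: "f \<in> borel_measurable borel" by (rule E_measurable[OF assms])
  have "AE x in \<pi>. (\<integral>\<^sup>+ y. ennreal \<bar>f y\<bar> * Phi x y \<partial>Pk x) < \<infinity>"
    using wd assms unfolding V_well_defined_def Phi_def by blast
  then show ?thesis
  proof eventually_elim
    case (elim x)
    show ?case
    proof (rule integrableI_bounded)
      have "(\<lambda>y. f y * enn2real (Phi x y)) \<in> borel_measurable borel" by measurable
      then show "(\<lambda>y. f y * phibar \<nu> \<phi> x y) \<in> borel_measurable (Pk x)"
        unfolding phibar_def Phi_def by (rule meas_Pk)
      have "ennreal (norm (f y * phibar \<nu> \<phi> x y)) \<le> ennreal \<bar>f y\<bar> * Phi x y" for y
      proof -
        have "ennreal (enn2real (Phi x y)) \<le> Phi x y" by (cases "Phi x y") auto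
        then have "ennreal \<bar>f y\<bar> * ennreal (enn2real (Phi x y)) \<le> ennreal \<bar>f y\<bar> * Phi x y"
          by (rule mult_left_mono) simp
        then show ?thesis by (simp add: phibar_def Phi_def abs_mult ennreal_mult)
      qed
      then have "(\<integral>\<^sup>+ y. ennreal (norm (f y * phibar \<nu> \<phi> x y)) \<partial>Pk x) \<le> (\<integral>\<^sup>+ y. ennreal \<bar>f y\<bar> * Phi x y \<partial>Pk x)"
        by (intro nn_integral_mono)
      then show "(\<integral>\<^sup>+ y. ennreal (norm (f y * phibar \<nu> \<phi> x y)) \<partial>Pk x) < \<infinity>"
        using elim by (rule le_less_trans)
    qed
  qed
qed

lemma phibar_nonneg: "0 \<le> phibar \<nu> \<phi> x y"
  by (simp add: phibar_def)

lemma pos_op_V: "pos_op V"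
  unfolding pos_op_def
proof (intro conjI allI impI)
  fix f assume f: "E f"
  show "E (V f)" using bdd f unfolding bounded_on_Lp_def by blast
  show "AE x in \<pi>. V (\<lambda>x. f x + g x) x = V f x + V g x" if "E g" for g
    using V_integrable[OF f] V_integrable[OF that]
    by eventually_elim (simp add: Vop_def distrib_right)
  show "AE x in \<pi>. V (\<lambda>x. c * f x) x = c * V f x" for c
    by (simp add: Vop_def mult.assoc)
  show "AE x in \<pi>. 0 \<le> V f x" if "AE x in \<pi>. 0 \<le> f x"
    using AE_stationary[OF that]
  proof eventually_elim
    case (elim x)
    then have "AE y in Pk x. 0 \<le> f y * phibar \<nu> \<phi> x y"
      by (auto elim!: eventually_mono simp: phibar_nonneg)
    then show ?case unfolding Vop_def by (rule integral_nonneg_AE)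
  qed
next
  show "\<exists>C. \<forall>f. E f \<longrightarrow> N (V f) \<le> C * N f"
    using bdd unfolding bounded_on_Lp_def by blast
qed

text \<open>\<open>phibar\<close> sends the value \<infinity> to 0, where it would differ from
  \<open>Phi\<close>. For almost every x this affects only a Pk x-null set, and integrability turns
  the remaining nonnegative integral into the Bochner integral.\<close>

lemma U_eq_V:
  assumes f: "E f" "AE x in \<pi>. 0 \<le> f x" and F: "AE x in \<pi>. F x = ennreal (f x)"
  shows "AE x in \<pi>. U F x = ennreal (V f x)"
  using V_integrable[OF f(1)] AE_stationary[OF f(2)] AE_stationary[OF F] Phi_finite
proof eventually_elim
  case (elim x)
  have "U F x = (\<integral>\<^sup>+ y. ennreal (f y * phibar \<nu> \<phi> x y) \<partial>Pk x)"
    unfolding U_def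
  proof (rule nn_integral_cong_AE)
    show "AE y in Pk x. Phi x y * F y = ennreal (f y * phibar \<nu> \<phi> x y)"
      using elim(2-4)
    proof eventually_elim
      case (elim y)
      then have "ennreal (phibar \<nu> \<phi> x y) = Phi x y" by (simp add: phibar_def Phi_def)
      then show ?case using elim by (simp add: ennreal_mult phibar_nonneg mult.commute)
    qed
  qed
  also have "\<dots> = ennreal (V f x)"
    unfolding Vop_def using elim(1)
    by (rule nn_integral_eq_integral) (use elim(2) in \<open>auto elim!: eventually_mono simp: phibar_nonneg\<close>)
  finally show ?case .
qed

lemma U_pow_eq_V_pow:
  assumes f: "E f" "AE x in \<pi>. 0 \<le> f x" and F: "AE x in \<pi>. F x = ennreal (f x)"
  shows "AE x in \<pi>. (U ^^ n) F x = ennreal ((V ^^ n) f x)"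
proof (induction n)
  case (Suc n)
  have "E ((V ^^ n) f)" "AE x in \<pi>. 0 \<le> (V ^^ n) f x"
    using op_E[OF pos_op_funpow[OF pos_op_V]] op_pos[OF pos_op_funpow[OF pos_op_V]] f by auto
  from U_eq_V[OF this Suc] show ?case by simp
qed (use F in simp)

text \<open>For \<open>U\<close> the conclusion holds at every x, by A2 applied to the set where f
  is positive. Agreement with V for all n at once costs only countably many null sets.\<close>

lemma V_irreducible:
  assumes A2: "\<And>B x. B \<in> sets borel \<Longrightarrow> emeasure \<pi> B > 0 \<Longrightarrow> \<exists>n\<ge>1. emeasure (kpow Pk n x) B > 0"
    and f: "E f" "AE x in \<pi>. 0 \<le> f x" "\<not> (AE x in \<pi>. f x = 0)"
  shows "AE x in \<pi>. \<exists>n. 0 < (V ^^ n) f x"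
proof -
  define F where "F x = ennreal (f x)" for x
  have [measurable]: "f \<in> borel_measurable borel" by (rule E_measurable[OF f(1)])
  have Fm [measurable]: "F \<in> borel_measurable borel" unfolding F_def by measurable
  define B where "B = {x. F x \<noteq> 0}"
  have Bs: "B \<in> sets borel" unfolding B_def by measurable
  have sp: "space \<pi> = UNIV" using sets_eq_imp_space_eq[OF sets_M] by simp
  have "emeasure \<pi> B \<noteq> 0"
  proof
    assume "emeasure \<pi> B = 0"
    then have "AE x in \<pi>. x \<notin> B" using Bs sets_M by (intro AE_not_in) (auto simp: null_sets_def)
    then have "AE x in \<pi>. f x = 0"
      using f(2) by eventually_elim (auto simp: B_def F_def ennreal_eq_0_iff)
    then show False using f(3) by simp
  qed
  then have Bpos: "emeasure \<pi> B > 0" by (simp add: zero_less_iff_neq_zero)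
  have ex: "\<exists>n. (U ^^ n) F x \<noteq> 0" for x
  proof -
    obtain n where n: "emeasure (kpow Pk n x) B > 0" using A2[OF Bs Bpos] by blast
    have "(U ^^ n) F x \<noteq> 0"
    proof
      assume "(U ^^ n) F x = 0"
      then have "AE y in kpow Pk n x. F y = 0" by (rule U_pow_eq_0D[OF Fm])
      then have "AE y in kpow Pk n x. y \<notin> B" by (auto simp: B_def)
      then have "emeasure (kpow Pk n x) B = 0"
        using Bs sets_kpow by (subst (asm) AE_iff_measurable[OF _ refl])
          (auto simp: sets_eq_imp_space_eq[OF sets_kpow])
      then show False using n by simp
    qed
    then show ?thesis by blast
  qed
  have "AE x in \<pi>. \<forall>n. (U ^^ n) F x = ennreal ((V ^^ n) f x)"
    using U_pow_eq_V_pow[OF f(1,2), of F] by (simp add: AE_all_countable F_def)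
  then show ?thesis
  proof eventually_elim
    case (elim x)
    obtain n where "(U ^^ n) F x \<noteq> 0" using ex by blast
    then have "0 < (V ^^ n) f x" using elim by (auto simp: ennreal_eq_0_iff not_le)
    then show ?case by blast
  qed
qed

lemma V_orbit_pos: "0 < N ((V ^^ n) (\<lambda>_. 1))"
proof -
  have E: "E ((V ^^ n) (\<lambda>_. 1))" by (rule op_E[OF pos_op_funpow[OF pos_op_V] E_const])
  have "N ((V ^^ n) (\<lambda>_. 1)) \<noteq> 0"
  proof
    assume "N ((V ^^ n) (\<lambda>_. 1)) = 0"
    then have "AE x in \<pi>. (V ^^ n) (\<lambda>_. 1) x = 0" using N_eq_0_iff[OF E] by simp
    moreover have "AE x in \<pi>. (U ^^ n) (\<lambda>_. 1) x = ennreal ((V ^^ n) (\<lambda>_. 1) x)"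
      by (rule U_pow_eq_V_pow[OF E_const]) auto
    ultimately have "AE x in \<pi>. False"
    proof eventually_elim
      case (elim x) then show ?case using U_pow_pos[of n x] by simp
    qed
    then show False by simp
  qed
  then show ?thesis using N_nonneg[of "(V ^^ n) (\<lambda>_. 1)"] by simp
qed

section \<open>Path expectations as iterates of \<open>U\<close>\<close>

lemma prod_shift:
  fixes h :: "nat \<Rightarrow> ennreal"
  shows "(\<Prod>t\<in>{1..Suc n}. h t) = h 1 * (\<Prod>t\<in>{1..n}. h (Suc t))"
  using prod.atLeast_Suc_atMost[of 1 "Suc n" h] prod.shift_bounds_cl_Suc_ivl[of h 1 n] by simp

text \<open>The constant \<open>c\<close> collects the factors of the steps already taken.\<close>

lemma pathE_prod:
  "pathE Pk \<nu> n x (\<lambda>X E. c * (\<Prod>t\<in>{1..n}. ennreal (\<phi> (X (t - 1)) (X t) (E t)))) = c * (U ^^ n) (\<lambda>_. 1) x"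
proof (induction n arbitrary: x c)
  case (Suc n)
  let ?W = "(U ^^ n) (\<lambda>_. 1)"
  have [measurable]: "?W \<in> borel_measurable borel" by (rule U_pow_measurable) simp
  have "pathE Pk \<nu> (Suc n) x (\<lambda>X E. c * (\<Prod>t\<in>{1..Suc n}. ennreal (\<phi> (X (t - 1)) (X t) (E t))))
     = (\<integral>\<^sup>+ y. \<integral>\<^sup>+ e. pathE Pk \<nu> n y (\<lambda>X E. (c * ennreal (\<phi> x y e)) * (\<Prod>t\<in>{1..n}. ennreal (\<phi> (X (t - 1)) (X t) (E t)))) \<partial>\<nu> \<partial>Pk x)"
    unfolding pathE.simps
  proof (intro nn_integral_cong pathE_cong)
    fix y e and X :: "nat \<Rightarrow> 'x" and E :: "nat \<Rightarrow> 'w"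
    assume "X 0 = y"
    let ?X = "case_nat x X" and ?E = "\<lambda>t. if t = 1 then e else E (t - 1)"
    have "(\<Prod>t\<in>{1..Suc n}. ennreal (\<phi> (?X (t - 1)) (?X t) (?E t)))
        = ennreal (\<phi> x y e) * (\<Prod>t\<in>{1..n}. ennreal (\<phi> (X (t - 1)) (X t) (E t)))"
      unfolding prod_shift using \<open>X 0 = y\<close>
      by (intro arg_cong2[of _ _ _ _ "(*)"] prod.cong) (auto split: nat.split)
    then show "c * (\<Prod>t\<in>{1..Suc n}. ennreal (\<phi> (?X (t - 1)) (?X t) (?E t)))
      = (c * ennreal (\<phi> x y e)) * (\<Prod>t\<in>{1..n}. ennreal (\<phi> (X (t - 1)) (X t) (E t)))"
      by (simp add: mult.assoc)
  qed
  also have "\<dots> = (\<integral>\<^sup>+ y. \<integral>\<^sup>+ e. ennreal (\<phi> x y e) * (c * ?W y) \<partial>\<nu> \<partial>Pk x)"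
    unfolding Suc by (simp add: ac_simps)
  also have "\<dots> = (\<integral>\<^sup>+ y. c * (Phi x y * ?W y) \<partial>Pk x)"
    by (subst nn_integral_multc) (use section_measurable[OF phi_meas] in \<open>simp_all add: Phi_def mult.left_commute\<close>)
  also have "\<dots> = c * U ?W x"
    unfolding U_def[of ?W x] by (intro nn_integral_cmult meas_Pk) measurable
  finally show ?case by simp
qed simp

lemma Eprod_eq: "Eprod Pk \<nu> \<phi> n x = (U ^^ n) (\<lambda>_. 1) x"
  using pathE_prod[of n x 1] by (simp add: Eprod_def)

context
  fixes g :: "'x \<Rightarrow> 'x \<Rightarrow> 'w \<Rightarrow> real"
  assumes g_meas: "(\<lambda>(x, y, e). g x y e) \<in> borel_measurable borel" and g_nonneg: "\<And>x y e. 0 \<le> g x y e"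
begin

definition Ghat :: "'x \<Rightarrow> ennreal" where
  "Ghat x = (\<integral>\<^sup>+ y. \<integral>\<^sup>+ e. ennreal (\<phi> x y e * g x y e) \<partial>\<nu> \<partial>Pk x)"

lemma phig_meas: "(\<lambda>(x, y, e). \<phi> x y e * g x y e) \<in> borel_measurable borel"
  using borel_measurable_times[OF phi_meas g_meas] by (simp add: case_prod_beta')

lemma Ghat_inner_measurable: "(\<lambda>y. \<integral>\<^sup>+ e. ennreal (\<phi> x y e * g x y e) \<partial>\<nu>) \<in> borel_measurable borel"
  using measurable_compose[OF measurable_Pair1' inner_integral_measurable[OF phig_meas], of x] by simp

lemma Ghat_measurable: "Ghat \<in> borel_measurable borel"
  unfolding Ghat_def[abs_def]
  by (rule nn_integral_measurable_subprob_algebra2[OF inner_integral_measurable[OF phig_meas] kernel_subprob])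

text \<open>The factor g is carried along until the last transition, where it merges with \<phi>
  into \<open>Ghat\<close>. Hence n + 1 path steps correspond to only n applications of
  \<open>U\<close>.\<close>

lemma pathE_prod_g:
  "pathE Pk \<nu> (Suc n) x (\<lambda>X E. c * ((\<Prod>t\<in>{1..Suc n}. ennreal (\<phi> (X (t - 1)) (X t) (E t))) * ennreal (g (X n) (X (Suc n)) (E (Suc n)))))
    = c * (U ^^ n) Ghat x"
proof (induction n arbitrary: x c)
  case 0
  have "(\<integral>\<^sup>+ y. \<integral>\<^sup>+ e. c * (ennreal (\<phi> x y e) * ennreal (g x y e)) \<partial>\<nu> \<partial>Pk x)
      = (\<integral>\<^sup>+ y. c * (\<integral>\<^sup>+ e. ennreal (\<phi> x y e * g x y e) \<partial>\<nu>) \<partial>Pk x)"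
    using section_measurable[OF phig_meas] phi_pos g_nonneg
    by (simp add: nn_integral_cmult less_imp_le flip: ennreal_mult)
  also have "\<dots> = c * Ghat x"
    unfolding Ghat_def by (intro nn_integral_cmult meas_Pk Ghat_inner_measurable)
  finally show ?case by simp
next
  case (Suc n)
  let ?W = "(U ^^ n) Ghat"
  have [measurable]: "?W \<in> borel_measurable borel" by (rule U_pow_measurable[OF Ghat_measurable])
  have "pathE Pk \<nu> (Suc (Suc n)) x (\<lambda>X E. c * ((\<Prod>t\<in>{1..Suc (Suc n)}. ennreal (\<phi> (X (t - 1)) (X t) (E t))) * ennreal (g (X (Suc n)) (X (Suc (Suc n))) (E (Suc (Suc n))))))
     = (\<integral>\<^sup>+ y. \<integral>\<^sup>+ e. pathE Pk \<nu> (Suc n) y (\<lambda>X E. (c * ennreal (\<phi> x y e)) * ((\<Prod>t\<in>{1..Suc n}. ennreal (\<phi> (X (t - 1)) (X t) (E t))) * ennreal (g (X n) (X (Suc n)) (E (Suc n))))) \<partial>\<nu> \<partial>Pk x)"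
    unfolding pathE.simps(2)[of _ _ "Suc n"]
  proof (intro nn_integral_cong pathE_cong)
    fix y e and X :: "nat \<Rightarrow> 'x" and E :: "nat \<Rightarrow> 'w"
    assume "X 0 = y"
    let ?X = "case_nat x X" and ?E = "\<lambda>t. if t = 1 then e else E (t - 1)"
    have "(\<Prod>t\<in>{1..Suc (Suc n)}. ennreal (\<phi> (?X (t - 1)) (?X t) (?E t)))
        = ennreal (\<phi> x y e) * (\<Prod>t\<in>{1..Suc n}. ennreal (\<phi> (X (t - 1)) (X t) (E t)))"
      unfolding prod_shift[of _ "Suc n"] using \<open>X 0 = y\<close>
      by (intro arg_cong2[of _ _ _ _ "(*)"] prod.cong) (auto split: nat.split)
    then show "c * ((\<Prod>t\<in>{1..Suc (Suc n)}. ennreal (\<phi> (?X (t - 1)) (?X t) (?E t))) * ennreal (g (?X (Suc n)) (?X (Suc (Suc n))) (?E (Suc (Suc n)))))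
      = (c * ennreal (\<phi> x y e)) * ((\<Prod>t\<in>{1..Suc n}. ennreal (\<phi> (X (t - 1)) (X t) (E t))) * ennreal (g (X n) (X (Suc n)) (E (Suc n))))"
      by (simp add: mult.assoc)
  qed
  also have "\<dots> = (\<integral>\<^sup>+ y. \<integral>\<^sup>+ e. ennreal (\<phi> x y e) * (c * ?W y) \<partial>\<nu> \<partial>Pk x)"
    unfolding Suc by (simp add: ac_simps)
  also have "\<dots> = (\<integral>\<^sup>+ y. c * (Phi x y * ?W y) \<partial>Pk x)"
    by (subst nn_integral_multc) (use section_measurable[OF phi_meas] in \<open>simp_all add: Phi_def mult.left_commute\<close>)
  also have "\<dots> = c * U ?W x"
    unfolding U_def[of ?W x] by (intro nn_integral_cmult meas_Pk) measurable
  finally show ?case by simp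
qed

lemma EprodG_eq: "EprodG Pk \<nu> \<phi> g (Suc n) x = (U ^^ n) Ghat x"
  using pathE_prod_g[of n x 1] by (simp add: EprodG_def)

text \<open>As \<phi> > 0, a vanishing integral of \<phi> g forces g = 0 almost surely, against A1.
  Finiteness is needed to conclude from \<open>ghat\<close>, since \<open>enn2real\<close> also
  sends \<infinity> to 0.\<close>

lemma ghat_not_null:
  assumes A1_G: "(\<integral>\<^sup>+ x. \<integral>\<^sup>+ y. \<integral>\<^sup>+ e. indicator {e. 0 < g x y e} e \<partial>\<nu> \<partial>Pk x \<partial>\<pi>) > 0"
    and fin: "AE x in \<pi>. Ghat x < \<infinity>"
  shows "\<not> (AE x in \<pi>. ghat Pk \<nu> \<phi> g x = 0)"
proof
  assume "AE x in \<pi>. ghat Pk \<nu> \<phi> g x = 0"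
  then have "AE x in \<pi>. (\<integral>\<^sup>+ y. \<integral>\<^sup>+ e. indicator {e. 0 < g x y e} e \<partial>\<nu> \<partial>Pk x) = (0::ennreal)"
    using fin
  proof eventually_elim
    case (elim x)
    then have "Ghat x = 0" by (auto simp: ghat_def Ghat_def enn2real_eq_0_iff)
    then have "AE y in Pk x. (\<integral>\<^sup>+ e. ennreal (\<phi> x y e * g x y e) \<partial>\<nu>) = 0"
      unfolding Ghat_def by (subst (asm) nn_integral_0_iff_AE) (auto intro: meas_Pk Ghat_inner_measurable)
    then have "AE y in Pk x. (\<integral>\<^sup>+ e. indicator {e. 0 < g x y e} e \<partial>\<nu>) = (0::ennreal)"
    proof eventually_elim
      case (elim y)
      then have "AE e in \<nu>. ennreal (\<phi> x y e * g x y e) = 0"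
        using section_measurable[OF phig_meas, of x y] by (subst (asm) nn_integral_0_iff_AE) auto
      then have "AE e in \<nu>. indicator {e. 0 < g x y e} e = (0::ennreal)"
        using phi_pos[of x y] by (auto elim!: eventually_mono simp: indicator_def ennreal_eq_0_iff mult_le_0_iff not_le[symmetric])
      then show ?case by (subst nn_integral_cong_AE[where v = "\<lambda>_. 0"]) auto
    qed
    then show ?case by (subst nn_integral_cong_AE[where v = "\<lambda>_. 0"]) auto
  qed
  then have "(\<integral>\<^sup>+ x. \<integral>\<^sup>+ y. \<integral>\<^sup>+ e. indicator {e. 0 < g x y e} e \<partial>\<nu> \<partial>Pk x \<partial>\<pi>) = 0"
    by (subst nn_integral_cong_AE[where v = "\<lambda>_. 0"]) auto
  then show False using A1_G by simp
qed

end

text \<open>The integral is the p-th power of the norm of V^n 1, so the p in the denominator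
  cancels. Since V^n 1 is a.e. finite, \<open>enn2real\<close> loses nothing.\<close>

lemma stab_seq_eq: "stab_seq p \<pi> Pk \<nu> \<phi> n = ln (N ((V ^^ n) (\<lambda>_. 1))) / real n"
proof -
  let ?f = "(V ^^ n) (\<lambda>_. 1)"
  have E: "E ?f" by (rule op_E[OF pos_op_funpow[OF pos_op_V] E_const])
  have nn: "AE x in \<pi>. 0 \<le> ?f x" by (rule op_pos[OF pos_op_funpow[OF pos_op_V] E_const]) auto
  have eq: "AE x in \<pi>. (U ^^ n) (\<lambda>_. 1) x = ennreal (?f x)"
    by (rule U_pow_eq_V_pow[OF E_const]) auto
  let ?I = "\<integral>x. \<bar>?f x\<bar> powr p \<partial>\<pi>"
  have "(\<integral>\<^sup>+ x. ennreal (enn2real (Eprod Pk \<nu> \<phi> n x) powr p) \<partial>\<pi>) = (\<integral>\<^sup>+ x. ennreal (\<bar>?f x\<bar> powr p) \<partial>\<pi>)"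
    by (rule nn_integral_cong_AE) (use eq nn in \<open>eventually_elim, simp add: Eprod_eq\<close>)
  also have "\<dots> = ennreal ?I"
    by (intro nn_integral_eq_integral E_integrable E) auto
  finally have *: "stab_seq p \<pi> Pk \<nu> \<phi> n = ln ?I / (real n * p)"
    by (simp add: stab_seq_def)
  have "?I \<noteq> 0" using V_orbit_pos[of n] by (auto simp: lpnorm_def)
  then have "ln (N ?f) = ln ?I / p" by (simp add: lpnorm_def ln_powr)
  then show ?thesis using * by (simp add: mult.commute)
qed

end

theorem theorem1:
  fixes Pk :: "'x::polish_space \<Rightarrow> 'x measure"
    and \<pi> :: "'x measure"
    and \<nu> :: "'w::polish_space measure"
    and \<phi> g :: "'x \<Rightarrow> 'x \<Rightarrow> 'w \<Rightarrow> real"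
    and p :: real
  assumes kernel: "Pk \<in> measurable borel (prob_algebra borel)"
    and pi_prob: "prob_space \<pi>" and pi_sets: "sets \<pi> = sets borel"
    and stationary: "\<forall>B\<in>sets borel. emeasure \<pi> B = (\<integral>\<^sup>+ x. emeasure (Pk x) B \<partial>\<pi>)"
    and nu_prob: "prob_space \<nu>" and nu_sets: "sets \<nu> = sets borel"
    and phi_meas: "(\<lambda>(x, y, e). \<phi> x y e) \<in> borel_measurable borel"
    and g_meas: "(\<lambda>(x, y, e). g x y e) \<in> borel_measurable borel"
    and phi_nonneg: "\<forall>x y e. 0 \<le> \<phi> x y e"
    and g_nonneg: "\<forall>x y e. 0 \<le> g x y e"
    \<comment> \<open>A1\<close>
    and A1_phi: "\<forall>x y e. 0 < \<phi> x y e"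
    and A1_G: "(\<integral>\<^sup>+ x. \<integral>\<^sup>+ y. \<integral>\<^sup>+ e. indicator {e. 0 < g x y e} e \<partial>\<nu> \<partial>Pk x \<partial>\<pi>) > 0"
    \<comment> \<open>A2\<close>
    and A2: "\<forall>B\<in>sets borel. emeasure \<pi> B > 0 \<longrightarrow>
               (\<forall>x. \<exists>n\<ge>1. emeasure (kpow Pk n x) B > 0)"
    \<comment> \<open>A3\<close>
    and p_ge: "1 \<le> p"
    and ghat_fin: "AE x in \<pi>. (\<integral>\<^sup>+ y. \<integral>\<^sup>+ e. ennreal (\<phi> x y e * g x y e) \<partial>\<nu> \<partial>Pk x) < \<infinity>"
    and ghat_Hp: "Hp p \<pi> (ghat Pk \<nu> \<phi> g)"
    and V_wd: "V_well_defined p \<pi> Pk \<nu> \<phi>"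
    and V_bdd: "bounded_on_Lp p \<pi> (Vop Pk \<nu> \<phi>)"
    and V_ev_compact: "\<exists>i. compact_on_Lp p \<pi> (Vop Pk \<nu> \<phi> ^^ i)"
  shows "(\<exists>L::real. stab_seq p \<pi> Pk \<nu> \<phi> \<longlonglongrightarrow> L) \<and>
    (let LL = lim (stab_seq p \<pi> Pk \<nu> \<phi>);
         sol = markov_solution p \<pi> Pk \<nu> \<phi> g;
         T = Top Pk \<nu> \<phi> g;
         a = (LL < 0);
         b = (\<exists>h. sol h);
         c = (\<exists>h. sol h \<and> (\<forall>h'. sol h' \<longrightarrow> (AE x in \<pi>. h' x = h x)));
         d = (\<exists>h f. Hp p \<pi> h \<and> Hp p \<pi> f \<and>
                 (\<lambda>n. lpnorm p \<pi> (\<lambda>x. (T ^^ n) h x - f x)) \<longlonglongrightarrow> 0);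
         e = (\<exists>hs. sol hs \<and> (\<forall>h'. sol h' \<longrightarrow> (AE x in \<pi>. h' x = hs x)) \<and>
                 (\<forall>h. Hp p \<pi> h \<longrightarrow>
                    (\<lambda>n. lpnorm p \<pi> (\<lambda>x. (T ^^ n) h x - hs x)) \<longlonglongrightarrow> 0))
     in (a \<longleftrightarrow> b) \<and> (a \<longleftrightarrow> c) \<and> (a \<longleftrightarrow> d) \<and> (a \<longleftrightarrow> e) \<and>
        (a \<longrightarrow> (\<forall>hs. sol hs \<longrightarrow>
           (AE x in \<pi>. ennreal (hs x) = (\<Sum>n. EprodG Pk \<nu> \<phi> g (Suc n) x)))))"
proof -
  interpret pr: prob_space \<pi> by (rule pi_prob)
  interpret nu: prob_space \<nu> by (rule nu_prob)
  interpret L: Lp_space \<pi> p by unfold_locales (rule p_ge pi_sets)+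
  interpret W: valuation \<pi> p Pk \<nu> \<phi>
  proof unfold_locales
    show "emeasure \<pi> B = (\<integral>\<^sup>+ x. emeasure (Pk x) B \<partial>\<pi>)" if "B \<in> sets borel" for B
      using stationary that by (rule bspec)
    show "0 < \<phi> x y e" for x y e using A1_phi by simp
  qed (rule kernel nu_sets phi_meas V_wd V_bdd)+
  let ?V = "Vop Pk \<nu> \<phi>" and ?T = "Top Pk \<nu> \<phi> g" and ?G = "ghat Pk \<nu> \<phi> g"
  obtain i where "compact_on_Lp p \<pi> (?V ^^ i)" using V_ev_compact by blast
  \<comment> \<open>The exponent given by A3 may be 0; one further composition with the bounded
    operator V keeps compactness and makes it at least 1.\<close>
  then have cpt: "compact_on_Lp p \<pi> (?V ^^ Suc i)"
    using L.compact_comp[OF W.pos_op_V _ L.pos_op_funpow[OF W.pos_op_V]] by simp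
  have G: "Lp p \<pi> ?G" "AE x in \<pi>. 0 \<le> ?G x" using ghat_Hp by (auto simp: Hp_def)
  interpret R: irreducible_op \<pi> p ?V "Suc i"
  proof unfold_locales
    show "AE x in \<pi>. \<exists>n. 0 < (?V ^^ n) f x"
      if "Lp p \<pi> f" "AE x in \<pi>. 0 \<le> f x" "\<not> (AE x in \<pi>. f x = 0)" for f
      using W.V_irreducible[OF _ that] A2 by blast
  qed (use W.pos_op_V cpt W.V_orbit_pos in auto)
  interpret F: affine_op \<pi> p ?V "Suc i" ?G ?T
    by unfold_locales (use G in \<open>auto simp: Top_def\<close>)
  have gm: "\<And>x y e. 0 \<le> g x y e" using g_nonneg by blast
  have Gfin: "AE x in \<pi>. W.Ghat g x < \<infinity>"
    using ghat_fin by (simp add: W.Ghat_def[OF g_meas gm])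
  have Gnz: "\<not> (AE x in \<pi>. ?G x = 0)" by (rule W.ghat_not_null[OF g_meas gm A1_G Gfin])
  have lim: "stab_seq p \<pi> Pk \<nu> \<phi> \<longlonglongrightarrow> R.growth"
    using R.orbit_growth by (simp add: W.stab_seq_eq[abs_def])
  define sol where "sol = markov_solution p \<pi> Pk \<nu> \<phi> g"
  have sol: "sol h \<longleftrightarrow> Hp p \<pi> h \<and> (AE x in \<pi>. h x = ?T h x)" for h
    by (simp add: sol_def markov_solution_def)
  define b where "b \<longleftrightarrow> (\<exists>h. sol h)"
  define c where "c \<longleftrightarrow> (\<exists>h. sol h \<and> (\<forall>h'. sol h' \<longrightarrow> (AE x in \<pi>. h' x = h x)))"
  define d where "d \<longleftrightarrow> (\<exists>h f. Hp p \<pi> h \<and> Hp p \<pi> f \<and>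
                 (\<lambda>n. lpnorm p \<pi> (\<lambda>x. (?T ^^ n) h x - f x)) \<longlonglongrightarrow> 0)"
  define e where "e \<longleftrightarrow> (\<exists>hs. sol hs \<and> (\<forall>h'. sol h' \<longrightarrow> (AE x in \<pi>. h' x = hs x)) \<and>
                 (\<forall>h. Hp p \<pi> h \<longrightarrow>
                    (\<lambda>n. lpnorm p \<pi> (\<lambda>x. (?T ^^ n) h x - hs x)) \<longlonglongrightarrow> 0))"
  \<comment> \<open>The equivalences are closed by a \<Rightarrow> e \<Rightarrow> c \<Rightarrow> b
    \<Rightarrow> a together with e \<Rightarrow> d \<Rightarrow> b.\<close>
  have ba: "R.growth < 0" if b
    using that F.growth_neg_if_fixed_point[OF _ _ _ Gnz] unfolding b_def sol Hp_def by blast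
  have ae: e if neg: "R.growth < 0"
  proof (rule F.fixed_point_if_growth_neg[OF neg])
    fix q
    assume q: "Lp p \<pi> q" "AE x in \<pi>. 0 \<le> q x" "AE x in \<pi>. q x = ?T q x"
      "\<And>h. Lp p \<pi> h \<Longrightarrow> (\<lambda>n. lpnorm p \<pi> (\<lambda>x. (?T ^^ n) h x - q x)) \<longlonglongrightarrow> 0"
      "\<And>h. Lp p \<pi> h \<Longrightarrow> AE x in \<pi>. h x = ?T h x \<Longrightarrow> AE x in \<pi>. h x = q x"
    have "sol q" using q by (simp add: sol Hp_def)
    moreover have "\<forall>h'. sol h' \<longrightarrow> (AE x in \<pi>. h' x = q x)"
      using q(5) by (simp add: sol Hp_def)
    moreover have "\<forall>h. Hp p \<pi> h \<longrightarrow> (\<lambda>n. lpnorm p \<pi> (\<lambda>x. (?T ^^ n) h x - q x)) \<longlonglongrightarrow> 0"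
      using q(4) by (simp add: Hp_def)
    ultimately show e unfolding e_def by blast
  qed
  have ec: c if e using that unfolding c_def e_def by blast
  have cb: b if c using that unfolding b_def c_def by blast
  have ed: d if e
  proof -
    obtain hs where "sol hs" "\<forall>h. Hp p \<pi> h \<longrightarrow>
                    (\<lambda>n. lpnorm p \<pi> (\<lambda>x. (?T ^^ n) h x - hs x)) \<longlonglongrightarrow> 0"
      using \<open>e\<close> unfolding e_def by blast
    then show d unfolding d_def sol by blast
  qed
  have db: b if d
  proof -
    obtain h f where "Hp p \<pi> h" "Hp p \<pi> f" "(\<lambda>n. lpnorm p \<pi> (\<lambda>x. (?T ^^ n) h x - f x)) \<longlonglongrightarrow> 0"
      using \<open>d\<close> unfolding d_def by blast
    then have "sol f" using F.limit_is_fixed_point[of h f] by (simp add: sol Hp_def)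
    then show b unfolding b_def by blast
  qed
  have series: "AE x in \<pi>. ennreal (hs x) = (\<Sum>n. EprodG Pk \<nu> \<phi> g (Suc n) x)"
    if neg: "R.growth < 0" and hs: "sol hs" for hs
  proof (rule F.fixed_point_if_growth_neg[OF neg])
    fix q
    assume qnn: "AE x in \<pi>. 0 \<le> q x" and q: "AE x in \<pi>. (\<lambda>n. F.S n x) \<longlonglongrightarrow> q x"
      "\<And>h. Lp p \<pi> h \<Longrightarrow> AE x in \<pi>. h x = ?T h x \<Longrightarrow> AE x in \<pi>. h x = q x"
    have "AE x in \<pi>. hs x = q x" using hs q(2) by (simp add: sol Hp_def)
    moreover have "AE x in \<pi>. \<forall>n. (W.U ^^ n) (W.Ghat g) x = ennreal ((?V ^^ n) ?G x)"
    proof -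
      have "AE x in \<pi>. W.Ghat g x = ennreal (?G x)"
        using Gfin by eventually_elim (simp add: ghat_def W.Ghat_def[OF g_meas gm])
      then show ?thesis using W.U_pow_eq_V_pow[OF G] by (simp add: AE_all_countable)
    qed
    ultimately show ?thesis using q(1) qnn F.pow_G_pos
    proof eventually_elim
      case (elim x)
      \<comment> \<open>The term V^n \<open>ghat\<close> is the expectation over n + 1 steps, so the
        series over n \<ge> 0 is the one over path lengths from 1 on.\<close>
      have "(\<lambda>n. ennreal ((?V ^^ n) ?G x)) sums ennreal (q x)"
        using elim by (intro sums_ennreal[THEN iffD2]) (auto simp: sums_def F.S_def)
      then show ?case using elim by (simp add: W.EprodG_eq[OF g_meas gm] sums_iff)
    qed
  qed
  have LL: "lim (stab_seq p \<pi> Pk \<nu> \<phi>) = R.growth" using lim by (rule limI)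
  have "\<exists>L. stab_seq p \<pi> Pk \<nu> \<phi> \<longlonglongrightarrow> L" using lim by blast
  moreover have "R.growth < 0 \<longleftrightarrow> b" "R.growth < 0 \<longleftrightarrow> c" "R.growth < 0 \<longleftrightarrow> d" "R.growth < 0 \<longleftrightarrow> e"
    using ba ae ec cb ed db by blast+
  moreover have "R.growth < 0 \<longrightarrow> (\<forall>hs. sol hs \<longrightarrow>
      (AE x in \<pi>. ennreal (hs x) = (\<Sum>n. EprodG Pk \<nu> \<phi> g (Suc n) x)))"
    using series by blast
  ultimately show ?thesis
    unfolding Let_def LL b_def c_def d_def e_def sol_def by (intro conjI) assumption+
qed

end
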